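(* Let $G=\langle s_1,\dots,s_r\rangle$ be a free group or free semigroup (with identity) of rank $r$. Let $\bar Y=(U,Y,\nu,\beta)$ be an ordered process over $G$. Then there exists a Markov process $\bar X=(T,X,\mu,\alpha)$ over $G$ (with $\alpha$ an ordered partition) such that $d_1(\bar X,\bar Y)=0$. Moreover, $\bar X$ is unique up to isomorphism (as an ordered process).
   Context: $G=\langle s_1,\dots,s_r\rangle$ is either a free group or a free semigroup with identity $e$ on $s_1,\dots,s_r$. Put $S=\{s_1^{\pm1},\dots,s_r^{\pm1}\}$ in the group case and $S=\{s_1,\dots,s_r\}$ in the semigroup case. $G\curvearrowright^T(X,\mathcal B,\mu)$ means that $(X,\mathcal B,\mu)$ is a standard probability space and $g\mapsto T_g$ is a homomorphism from $G$ to the semigroup of measure-preserving transformations of $X$. Partitions are measurable and finite or countably infinite, and are considered up to measure zero. An ordered process is a quadruple $(T,X,\mu,\alpha)$ where $G\curvearrowright^T(X,\mathcal B,\mu)$ and $\alpha=(A_1,A_2,\dots)$ is an ordered partition of $X$; if $\alpha=(A_1,\dots,A_n)$ is finite, put $A_i=\emptyset$ for $i>n$. Two ordered processes are isomorphic (as ordered processes) if there is a measure-conjugacy (an invertible, measure-preserving, $G$-equivariant map between conull sets) sending the $i$-th atom of the first partition to the $i$-th atom of the second for all $i\ge1$. For $\bar X=(T,X,\mu,\alpha)$, $\bar Y=(U,Y,\nu,\beta)$ with $\alpha=(A_1,A_2,\dots)$, $\beta=(B_1,B_2,\dots)$, $$d_1(\bar X,\bar Y)=\sum_{s\in S}\sum_{i,j=1}^\infty\big|\mu(A_i\cap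 T_s^{-1}A_j)-\nu(B_i\cap U_s^{-1}B_j)\big|.$$ The left-Cayley graph $\Gamma_L$ has vertex set $G$ and an edge from $g$ to $sg$ for every $g\in G$, $s\in S$; paths in $\Gamma_L$ ignore edge directions. $\mathrm{Past}(g_1;g_2)$ is the set of $f\in G$ such that every path in $\Gamma_L$ from $f$ to $g_1$ passes through $g_2$. A process $(T,X,\mu,\alpha)$ (that is, $G\curvearrowright^T(X,\mathcal B,\mu)$ together with a partition $\alpha$ of $X$) is a Markov process if for every $s\in S$, $g\in G$, $A\in\alpha$, $$\mu\Big(T_{sg}^{-1}A\,\Big|\bigvee_{f\in\mathrm{Past}(sg;g)}T_f^{-1}\alpha\Big)(x)=\mu(T_{sg}^{-1}A\,|\,T_g^{-1}\alpha)(x)=\mu(T_s^{-1}A\,|\,\alpha)(T_gx)\quad\text{for }\mu\text{-a.e. }x,$$ where the second equality holds automatically because $T_g$ preserves $\mu$, $\mu(E|\mathcal F)$ denotes the conditional expectation of the characteristic function of $E$ with respect to the $\sigma$-algebra $\mathcal F$, and joins of partitions are identified with the $\sigma$-algebras they generate.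
   Formalization: Uniqueness is proved among Markov processes whose partition generates the σ-algebra mod null sets under G (existence gives such a one), and rank r ≥ 1 is assumed; without generation uniqueness fails, e.g. for the trivial partition. *)

theory Defs
  imports "HOL-Probability.Probability" "HOL-Algebra.Group"
begin

section \<open>Free groups and free semigroups\<close>

text \<open>A monoid is free on \<open>s 1, \<dots>, s r\<close> if every element is the value of exactly one word
  in the generators.\<close>

definition free_semigroup_on :: "('g, 'm) monoid_scheme \<Rightarrow> (nat \<Rightarrow> 'g) \<Rightarrow> nat \<Rightarrow> bool" where
  "free_semigroup_on G s r \<longleftrightarrow>
     monoid G \<and> s ` {1..r} \<subseteq> carrier G \<and>
     bij_betw (\<lambda>w. foldr (\<lambda>i g. s i \<otimes>\<^bsub>G\<^esub> g) w \<one>\<^bsub>G\<^esub>) (lists {1..r}) (carrier G)"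

text \<open>A group is free on \<open>s 1, \<dots>, s r\<close> if every element is the value of exactly one reduced
  word. The letter \<open>(i, True)\<close> stands for \<open>s i\<close> and \<open>(i, False)\<close> for its inverse.\<close>

definition letter :: "('g, 'm) monoid_scheme \<Rightarrow> (nat \<Rightarrow> 'g) \<Rightarrow> nat \<times> bool \<Rightarrow> 'g" where
  "letter G s l = (if snd l then s (fst l) else inv\<^bsub>G\<^esub> (s (fst l)))"

definition reduced_words :: "nat \<Rightarrow> (nat \<times> bool) list set" where
  "reduced_words r =
     {w \<in> lists ({1..r} \<times> UNIV). successively (\<lambda>k l. \<not> (fst k = fst l \<and> snd k \<noteq> snd l)) w}"

definition free_group_on :: "('g, 'm) monoid_scheme \<Rightarrow> (nat \<Rightarrow> 'g) \<Rightarrow> nat \<Rightarrow> bool" where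
  "free_group_on G s r \<longleftrightarrow>
     group G \<and> s ` {1..r} \<subseteq> carrier G \<and>
     bij_betw (\<lambda>w. foldr (\<lambda>l g. letter G s l \<otimes>\<^bsub>G\<^esub> g) w \<one>\<^bsub>G\<^esub>) (reduced_words r) (carrier G)"


section \<open>The left Cayley graph\<close>

text \<open>Vertex lists of paths, edge directions ignored. Repeated vertices are allowed; this does not
  affect \<open>Past\<close>, as the vertices of some simple path are among those of any walk with the
  same end points.\<close>

definition cayley_path :: "('g, 'm) monoid_scheme \<Rightarrow> 'g set \<Rightarrow> 'g \<Rightarrow> 'g \<Rightarrow> 'g list \<Rightarrow> bool" where
  "cayley_path G S f h p \<longleftrightarrow>
     p \<noteq> [] \<and> set p \<subseteq> carrier G \<and> hd p = f \<and> last p = h \<and>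
     successively (\<lambda>x y. \<exists>s\<in>S. y = s \<otimes>\<^bsub>G\<^esub> x \<or> x = s \<otimes>\<^bsub>G\<^esub> y) p"

definition Past :: "('g, 'm) monoid_scheme \<Rightarrow> 'g set \<Rightarrow> 'g \<Rightarrow> 'g \<Rightarrow> 'g set" where
  "Past G S g1 g2 = {f \<in> carrier G. \<forall>p. cayley_path G S f g1 p \<longrightarrow> g2 \<in> set p}"


section \<open>Ordered processes\<close>

text \<open>\<open>standard_prob_space\<close>: a probability measure on the Borel sets of a Polish space.\<close>

definition standard_prob_space :: "'x measure \<Rightarrow> bool" where
  "standard_prob_space M \<longleftrightarrow>
     prob_space M \<and>
     (\<exists>\<T>. topspace \<T> = space M \<and> completely_metrizable_space \<T> \<and> second_countable \<T> \<and>
          sets M = sigma_sets (space M) {V. openin \<T> V})"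

text \<open>Atoms are indexed from \<open>0\<close>. A finite partition is padded by empty sets.\<close>

record ('g, 'x) process =
  msr :: "'x measure"
  act :: "'g \<Rightarrow> 'x \<Rightarrow> 'x"
  atom :: "nat \<Rightarrow> 'x set"

definition ordered_process :: "('g, 'm) monoid_scheme \<Rightarrow> ('g, 'x) process \<Rightarrow> bool" where
  "ordered_process G X \<longleftrightarrow>
     standard_prob_space (msr X) \<and>
     (\<forall>g\<in>carrier G. act X g \<in> measurable (msr X) (msr X) \<and>
        distr (msr X) (msr X) (act X g) = msr X) \<and>
     (\<forall>x\<in>space (msr X). act X \<one>\<^bsub>G\<^esub> x = x) \<and>
     (\<forall>g\<in>carrier G. \<forall>h\<in>carrier G. \<forall>x\<in>space (msr X).
        act X (g \<otimes>\<^bsub>G\<^esub> h) x = act X g (act X h x)) \<and>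
     (\<forall>i. atom X i \<in> sets (msr X)) \<and> disjoint_family (atom X) \<and>
     (\<Union>i. atom X i) = space (msr X)"

definition translate :: "('g, 'x) process \<Rightarrow> 'g \<Rightarrow> nat \<Rightarrow> 'x set" where
  "translate X g i = act X g -` atom X i \<inter> space (msr X)"

text \<open>The \<open>\<sigma>\<close>-algebra generated by the translates of the partition by the elements of \<open>F\<close>.\<close>

definition join :: "('g, 'x) process \<Rightarrow> 'g set \<Rightarrow> 'x measure" where
  "join X F = sigma (space (msr X)) {translate X f i | f i. f \<in> F}"

text \<open>Uniqueness up to isomorphism requires the translates of the partition to generate the whole
  \<open>\<sigma>\<close>-algebra modulo null sets: every action is a Markov process for the trivial partition.\<close>

definition generating :: "('g, 'm) monoid_scheme \<Rightarrow> ('g, 'x) process \<Rightarrow> bool" where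
  "generating G X \<longleftrightarrow>
     (\<forall>B\<in>sets (msr X). \<exists>C\<in>sets (join X (carrier G)). (B - C) \<union> (C - B) \<in> null_sets (msr X))"

text \<open>The sums are taken in \<open>ennreal\<close>, so that no convergence is presupposed. For ordered processes
  the value is at most \<open>2 * card S\<close>.\<close>

definition d1 :: "'g set \<Rightarrow> ('g, 'x) process \<Rightarrow> ('g, 'y) process \<Rightarrow> ennreal" where
  "d1 S X Y = (\<Sum>s\<in>S. \<Sum>i. \<Sum>j.
     ennreal \<bar>measure (msr X) (atom X i \<inter> translate X s j)
            - measure (msr Y) (atom Y i \<inter> translate Y s j)\<bar>)"

definition markov_process ::
  "('g, 'm) monoid_scheme \<Rightarrow> 'g set \<Rightarrow> ('g, 'x) process \<Rightarrow> bool" where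
  "markov_process G S X \<longleftrightarrow>
     ordered_process G X \<and>
     (\<forall>s\<in>S. \<forall>g\<in>carrier G. \<forall>i. AE x in msr X.
        real_cond_exp (msr X) (join X (Past G S (s \<otimes>\<^bsub>G\<^esub> g) g))
          (indicat_real (translate X (s \<otimes>\<^bsub>G\<^esub> g) i)) x
        = real_cond_exp (msr X) (join X {g}) (indicat_real (translate X (s \<otimes>\<^bsub>G\<^esub> g) i)) x
      \<and> real_cond_exp (msr X) (join X {g}) (indicat_real (translate X (s \<otimes>\<^bsub>G\<^esub> g) i)) x
        = real_cond_exp (msr X) (join X {\<one>\<^bsub>G\<^esub>}) (indicat_real (translate X s i)) (act X g x))"

definition process_isomorphic ::
  "('g, 'm) monoid_scheme \<Rightarrow> ('g, 'x) process \<Rightarrow> ('g, 'y) process \<Rightarrow> bool" where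
  "process_isomorphic G X Y \<longleftrightarrow>
     (\<exists>X0 Y0 \<phi>.
        X0 \<in> sets (msr X) \<and> space (msr X) - X0 \<in> null_sets (msr X) \<and>
        Y0 \<in> sets (msr Y) \<and> space (msr Y) - Y0 \<in> null_sets (msr Y) \<and>
        bij_betw \<phi> X0 Y0 \<and>
        \<phi> \<in> measurable (restrict_space (msr X) X0) (restrict_space (msr Y) Y0) \<and>
        the_inv_into X0 \<phi> \<in> measurable (restrict_space (msr Y) Y0) (restrict_space (msr X) X0) \<and>
        distr (restrict_space (msr X) X0) (restrict_space (msr Y) Y0) \<phi>
          = restrict_space (msr Y) Y0 \<and>
        (\<forall>g\<in>carrier G. \<forall>x\<in>X0. act X g x \<in> X0 \<and> \<phi> (act X g x) = act Y g (\<phi> x)) \<and>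
        (\<forall>i. \<phi> ` (atom X i \<inter> X0) = atom Y i \<inter> Y0))"

end

theory Submission
  imports Defs
begin

text \<open>The left Cayley graph of \<open>G\<close> is a tree. For \<open>p a = \<nu>(B\<^sub>a)\<close> and
  \<open>p a * P s a b = \<nu>(B\<^sub>a \<inter> U\<^sub>s\<^sup>-\<^sup>1 B\<^sub>b)\<close>, the process sought is the stationary Markov chain indexed
  by this tree, with distribution \<open>p\<close> at each vertex and transition probabilities \<open>P s\<close> along the
  edges from \<open>g\<close> to \<open>s \<otimes> g\<close>.

  Uniqueness. Let a finite subtree grow from the identity. The Markov property multiplies the
  probability of a cylinder by one transition probability per new vertex (\<open>tree_markov_cyl\<close>), so \<open>p\<close>
  and \<open>P\<close> determine the joint law of all translates of the partition (\<open>weight_law_unique\<close>). If the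
  translates generate the \<open>\<sigma>\<close>-algebra modulo null sets, a point is recovered from its name almost
  everywhere. On a standard space the recovery is measurable (\<open>measurable_left_inverse_mod_null\<close>),
  and two generating processes with the same law are isomorphic through their names
  (\<open>generating_same_law_isomorphic\<close>).

  Existence. A chain with the right finite-dimensional distributions is driven by independent
  noise (\<open>weight_law_exists\<close>). It has the Markov property along all edges (\<open>weight_law_markov\<close>):
  away from the root by the product formula; towards the root, in the group case, by the
  reversibility \<open>\<nu>(B\<^sub>b \<inter> U\<^sub>t\<^sup>-\<^sup>1 B\<^sub>a) = \<nu>(B\<^sub>a \<inter> U\<^sub>s\<^sup>-\<^sup>1 B\<^sub>b)\<close> for \<open>t = s\<^sup>-\<^sup>1\<close>. Shift invariance is
  not computed but deduced from uniqueness: right multiplication carries pasts into pasts, hence the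
  translated chain is a Markov chain with the same \<open>p\<close> and \<open>P\<close> and has the same law
  (\<open>shift_process_markov\<close>).

  Groups and semigroups are treated together: a word length for which every vertex other than
  the identity has exactly one parent, and compatibility of pasts with right multiplication, carry
  the argument (\<open>shift_cayley_tree\<close>).\<close>

section \<open>The left Cayley graph as a rooted tree\<close>

text \<open>What free groups and free semigroups share: the left Cayley graph is a tree rooted at the
  identity, with \<open>len\<close> the distance to the root. An edge from \<open>g\<close> to \<open>s \<otimes> g\<close> leads away from the
  root, or it leads back along the edge of a left inverse of \<open>s\<close>, which happens only in the group.\<close>

locale left_cayley_tree = monoid G for G :: "('g, 'm) monoid_scheme" (structure) +
  fixes S :: "'g set" and len :: "'g \<Rightarrow> nat"
  assumes S_carrier: "S \<subseteq> carrier G"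
    and S_finite: "finite S" and S_nonempty: "S \<noteq> {}"
    and carrier_countable: "countable (carrier G)"
    and len_eq_0: "g \<in> carrier G \<Longrightarrow> len g = 0 \<longleftrightarrow> g = \<one>"
    and parent_exists:
      "g \<in> carrier G \<Longrightarrow> g \<noteq> \<one> \<Longrightarrow> \<exists>s\<in>S. \<exists>h\<in>carrier G. g = s \<otimes> h \<and> len g = Suc (len h)"
    and parent_unique:
      "\<lbrakk>s \<in> S; s' \<in> S; h \<in> carrier G; h' \<in> carrier G; s \<otimes> h = s' \<otimes> h';
        len (s \<otimes> h) = Suc (len h); len (s \<otimes> h) = Suc (len h')\<rbrakk> \<Longrightarrow> s = s' \<and> h = h'"
    and edge_up_or_down:
      "s \<in> S \<Longrightarrow> g \<in> carrier G \<Longrightarrow>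
         len (s \<otimes> g) = Suc (len g) \<or> (len g = Suc (len (s \<otimes> g)) \<and> (\<exists>s'\<in>S. s' \<otimes> s = \<one>))"
begin

lemma S_closed [simp]: "s \<in> S \<Longrightarrow> s \<in> carrier G"
  using S_carrier by auto

lemma len_one [simp]: "len \<one> = 0"
  using len_eq_0 by auto

definition child :: "'g \<Rightarrow> 'g \<Rightarrow> 'g \<Rightarrow> bool" where
  "child s h f \<longleftrightarrow> s \<in> S \<and> h \<in> carrier G \<and> f = s \<otimes> h \<and> len f = Suc (len h)"

lemma child_carrier: "child s h f \<Longrightarrow> s \<in> S \<and> h \<in> carrier G \<and> f \<in> carrier G"
  unfolding child_def by auto

lemma child_unique: "child s h f \<Longrightarrow> child s' h' f \<Longrightarrow> s = s' \<and> h = h'"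
  unfolding child_def using parent_unique by metis

lemma child_not_one: "child s h f \<Longrightarrow> f \<noteq> \<one>"
  unfolding child_def by auto

definition par :: "'g \<Rightarrow> 'g" where
  "par f = (SOME h. \<exists>s. child s h f)"

definition lab :: "'g \<Rightarrow> 'g" where
  "lab f = (SOME s. child s (par f) f)"

lemma par_lab: assumes "f \<in> carrier G" "f \<noteq> \<one>" shows "child (lab f) (par f) f"
proof -
  have "\<exists>h s. child s h f" using parent_exists[OF assms] unfolding child_def using assms(1) by metis
  then have "\<exists>s. child s (par f) f" unfolding par_def by (rule someI_ex)
  then show ?thesis unfolding lab_def by (rule someI_ex)
qed

lemma child_par_lab: assumes "child s h f" shows "par f = h" "lab f = s"
  using par_lab[of f] child_unique[OF assms] child_carrier[OF assms] child_not_one[OF assms] by metis+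

inductive_set desc :: "'g \<Rightarrow> 'g set" for k where
  desc_base: "k \<in> desc k"
| desc_step: "h \<in> desc k \<Longrightarrow> child s h f \<Longrightarrow> f \<in> desc k"

lemma desc_carrier: "f \<in> desc k \<Longrightarrow> k \<in> carrier G \<Longrightarrow> f \<in> carrier G"
  by (induction rule: desc.induct) (auto dest: child_carrier)

lemma desc_len: "f \<in> desc k \<Longrightarrow> f = k \<or> len k < len f"
  by (induction rule: desc.induct) (auto simp: child_def)

lemma desc_parent: assumes "f \<in> desc k" "child s h f" shows "f = k \<or> h \<in> desc k"
  using assms(1)
proof (cases rule: desc.cases)
  case desc_base then show ?thesis by simp
next
  case (desc_step h' s') then show ?thesis using child_unique[OF assms(2)] by blast
qed

definition adj :: "'g \<Rightarrow> 'g \<Rightarrow> bool" where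
  "adj x y \<longleftrightarrow> x \<in> carrier G \<and> y \<in> carrier G \<and> (\<exists>s\<in>S. y = s \<otimes> x \<or> x = s \<otimes> y)"

lemma adj_sym: "adj x y \<Longrightarrow> adj y x"
  unfolding adj_def by auto

lemma adj_child: assumes "adj x y" shows "(\<exists>s. child s x y) \<or> (\<exists>s. child s y x)"
proof -
  have *: "(\<exists>s. child s x y) \<or> (\<exists>s. child s y x)"
    if "s \<in> S" "x \<in> carrier G" "y = s \<otimes> x" for s x y
    using edge_up_or_down[OF that(1,2)]
  proof
    assume "len (s \<otimes> x) = Suc (len x)"
    then show ?thesis using that unfolding child_def by auto
  next
    assume "len x = Suc (len (s \<otimes> x)) \<and> (\<exists>s'\<in>S. s' \<otimes> s = \<one>)"
    then obtain s' where s': "s' \<in> S" "s' \<otimes> s = \<one>" "len x = Suc (len (s \<otimes> x))" by auto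
    then have "x = s' \<otimes> y" using that by (simp flip: m_assoc)
    then have "child s' y x" using that s' unfolding child_def by simp
    then show ?thesis by blast
  qed
  show ?thesis using assms *[of _ x y] *[of _ y x] unfolding adj_def by auto
qed

lemma child_adj: "child s h f \<Longrightarrow> adj h f"
  unfolding child_def adj_def by auto

text \<open>Membership in \<open>Past\<close> is a statement about reachability in the graph with one vertex removed.
  The closure of a symmetric relation is easier to concatenate and to reverse than vertex lists.\<close>

definition step_avoiding :: "'g \<Rightarrow> 'g \<Rightarrow> 'g \<Rightarrow> bool" where
  "step_avoiding g x y \<longleftrightarrow> x \<noteq> g \<and> y \<noteq> g \<and> adj x y"

lemma step_avoiding_sym: "symp (step_avoiding g)"
  by (rule sympI) (auto simp: step_avoiding_def adj_sym)

lemma Past_iff: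
  assumes "f \<in> carrier G"
  shows "f \<in> Past G S k g \<longleftrightarrow> \<not> (f \<noteq> g \<and> (step_avoiding g)\<^sup>*\<^sup>* f k)"
proof -
  have 1: "f \<noteq> g \<and> (step_avoiding g)\<^sup>*\<^sup>* f k" if "cayley_path G S f k p" "g \<notin> set p" for p f
    using that
  proof (induction p arbitrary: f)
    case Nil
    then show ?case by (simp add: cayley_path_def)
  next
    case (Cons x p)
    have x: "x = f" using Cons.prems by (simp add: cayley_path_def)
    show ?case
    proof (cases p)
      case Nil
      then show ?thesis using Cons.prems by (auto simp: cayley_path_def)
    next
      case (Cons y q)
      have "cayley_path G S y k p" using Cons.prems Cons by (auto simp: cayley_path_def)
      then have "y \<noteq> g \<and> (step_avoiding g)\<^sup>*\<^sup>* y k" using Cons.IH Cons.prems by auto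
      moreover have "step_avoiding g f y"
        using Cons.prems Cons x unfolding step_avoiding_def adj_def by (auto simp: cayley_path_def)
      ultimately show ?thesis
        by (meson converse_rtranclp_into_rtranclp step_avoiding_def)
    qed
  qed
  have 2: "\<exists>p. cayley_path G S f k p \<and> g \<notin> set p"
    if "(step_avoiding g)\<^sup>*\<^sup>* f k" "f \<noteq> g" "f \<in> carrier G" for f
    using that
  proof (induction rule: converse_rtranclp_induct)
    case base
    then show ?case by (intro exI[of _ "[k]"]) (auto simp: cayley_path_def)
  next
    case (step x y)
    then obtain p where p: "cayley_path G S y k p" "g \<notin> set p"
      unfolding step_avoiding_def adj_def by auto
    then show ?case using step(1,4)
      by (intro exI[of _ "x # p"])
        (cases p; auto simp: cayley_path_def step_avoiding_def adj_def)
  qed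
  show ?thesis unfolding Past_def using 1 2 assms by blast
qed

lemma Past_carrier: "Past G S k g \<subseteq> carrier G"
  unfolding Past_def by auto

lemma self_in_Past: "g \<in> carrier G \<Longrightarrow> g \<in> Past G S k g"
  by (simp add: Past_iff)

lemma parent_not_desc: "child s g f \<Longrightarrow> g \<notin> desc f"
  using desc_len unfolding child_def by fastforce

lemma desc_reach: assumes "f \<in> desc k" "g \<notin> desc k" "k \<in> carrier G"
  shows "(step_avoiding g)\<^sup>*\<^sup>* f k"
  using assms
proof (induction rule: desc.induct)
  case (desc_step h s f)
  have "f \<in> desc k" using desc_step by (meson desc.desc_step)
  then have "step_avoiding g f h"
    using desc_step child_adj adj_sym unfolding step_avoiding_def by metis
  then show ?case using desc_step by (meson converse_rtranclp_into_rtranclp)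
qed simp

text \<open>Seen from a child \<open>k\<close> of \<open>g\<close>, the edge to \<open>g\<close> is the only exit from the branch above \<open>k\<close>, and
  the branch itself is connected without passing through \<open>g\<close>.\<close>

lemma Past_child:
  assumes c: "child s g k"
  shows "Past G S k g = carrier G - desc k"
proof -
  have "f \<in> Past G S k g \<longleftrightarrow> f \<notin> desc k" if f: "f \<in> carrier G" for f
  proof
    assume "f \<in> Past G S k g"
    then show "f \<notin> desc k"
      using Past_iff[OF f] desc_reach[OF _ parent_not_desc[OF c]] parent_not_desc[OF c]
        child_carrier[OF c] by metis
  next
    assume "f \<notin> desc k"
    have "x \<in> desc k" if "(step_avoiding g)\<^sup>*\<^sup>* x k" for x
      using that
    proof (induction rule: converse_rtranclp_induct)
      case (step x y)
      from step(1) have "x \<noteq> g" "adj y x" by (auto simp: step_avoiding_def adj_sym)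
      then show ?case
        using adj_child[of y x] desc_step[OF step(3)] desc_parent[OF step(3)] child_unique[OF c]
        by metis
    qed (rule desc_base)
    then show "f \<in> Past G S k g" using Past_iff[OF f] \<open>f \<notin> desc k\<close> by blast
  qed
  then show ?thesis using Past_carrier by blast
qed

text \<open>Seen from the parent \<open>k\<close> of \<open>g\<close>: a vertex outside the branch above \<open>g\<close> reaches \<open>k\<close> by way of
  the root, outside that branch.\<close>

lemma Past_parent:
  assumes c: "child s k g"
  shows "Past G S k g \<subseteq> desc g"
proof
  fix f assume f: "f \<in> Past G S k g"
  then have fc: "f \<in> carrier G" using Past_carrier by auto
  have reach: "(step_avoiding g)\<^sup>*\<^sup>* x \<one>" if "x \<in> carrier G" "x \<notin> desc g" for x
    using that
  proof (induction "len x" arbitrary: x)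
    case 0
    then show ?case using len_eq_0 by auto
  next
    case (Suc n)
    then have ch: "child (lab x) (par x) x" by (intro par_lab) auto
    then have "par x \<notin> desc g" using Suc(4) by (meson desc_step)
    moreover have "len (par x) = n" "par x \<in> carrier G" using ch Suc(2) by (auto simp: child_def)
    ultimately have "(step_avoiding g)\<^sup>*\<^sup>* (par x) \<one>" using Suc(1) by auto
    moreover have "step_avoiding g x (par x)"
      using child_adj[OF ch] \<open>par x \<notin> desc g\<close> Suc(4) desc_base unfolding step_avoiding_def
      by (metis adj_sym)
    ultimately show ?case by (meson converse_rtranclp_into_rtranclp)
  qed
  have k: "k \<in> carrier G" "k \<notin> desc g" using child_carrier[OF c] parent_not_desc[OF c] by auto
  show "f \<in> desc g"
  proof (rule ccontr)
    assume nf: "f \<notin> desc g"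
    have "(step_avoiding g)\<^sup>*\<^sup>* \<one> k"
      using reach[OF k] step_avoiding_sym by (metis symp_rtranclp sympD)
    then have "(step_avoiding g)\<^sup>*\<^sup>* f k" using reach[OF fc nf] by simp
    moreover have "f \<noteq> g" using nf desc_base by auto
    ultimately show False using f Past_iff[OF fc] by auto
  qed
qed

lemma shallow_in_Past:
  assumes "child s g k" "f \<in> carrier G" "f \<noteq> k" "len f \<le> len k"
  shows "f \<in> Past G S k g"
  using assms desc_len[of f k] by (auto simp: Past_child)

lemma edge_cases:
  assumes "s \<in> S" "g \<in> carrier G"
  obtains (up) "child s g (s \<otimes> g)" | (down) s' where "child s' (s \<otimes> g) g" "s' \<otimes> s = \<one>"
proof -
  have g: "g = s' \<otimes> (s \<otimes> g)" if "s' \<in> S" "s' \<otimes> s = \<one>" for s'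
    using that assms by (simp flip: m_assoc)
  show thesis using edge_up_or_down[OF assms] up down g assms unfolding child_def
    by (metis S_closed m_closed)
qed

lemma desc_trans: "f \<in> desc h \<Longrightarrow> h \<in> desc k \<Longrightarrow> f \<in> desc k"
  by (induction rule: desc.induct) (auto intro: desc_step)

lemma desc_one: "desc \<one> = carrier G"
proof
  have "f \<in> desc \<one>" if "f \<in> carrier G" for f
    using that
  proof (induction "len f" arbitrary: f)
    case 0
    then show ?case using len_eq_0 desc_base by auto
  next
    case (Suc n)
    then have ch: "child (lab f) (par f) f" by (intro par_lab) auto
    moreover have "par f \<in> desc \<one>" using Suc ch by (auto simp: child_def)
    ultimately show ?case by (rule desc_step[rotated])
  qed
  then show "carrier G \<subseteq> desc \<one>" by auto
qed (use desc_carrier in auto)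

text \<open>Finite subtrees with root \<open>r\<close>. Roots other than the identity serve the past of an edge that
  leads towards the identity, which lies in a branch.\<close>

definition rooted :: "'g \<Rightarrow> 'g set \<Rightarrow> bool" where
  "rooted r F \<longleftrightarrow> finite F \<and> F \<subseteq> desc r \<and> r \<in> F \<and> (\<forall>f\<in>F - {r}. par f \<in> F)"

lemma rooted_Un: "rooted r F \<Longrightarrow> rooted r F' \<Longrightarrow> rooted r (F \<union> F')"
  unfolding rooted_def by auto

lemma rooted_single: "rooted r {r}"
  unfolding rooted_def by (auto simp: desc_base)

lemma rooted_insert: "rooted r F \<Longrightarrow> child s h f \<Longrightarrow> h \<in> F \<Longrightarrow> rooted r (insert f F)"
  unfolding rooted_def by (auto simp: child_par_lab intro: desc_step)

lemma rooted_hull: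
  assumes "f \<in> desc r"
  shows "\<exists>F. rooted r F \<and> f \<in> F \<and> (\<forall>h\<in>F. f \<in> desc h)"
  using assms
proof (induction rule: desc.induct)
  case desc_base
  then show ?case using rooted_single desc.desc_base by blast
next
  case (desc_step h s f)
  then obtain F where "rooted r F" "h \<in> F" "\<forall>k\<in>F. h \<in> desc k" by auto
  then show ?case using rooted_insert[OF _ desc_step(2)] desc_step(2)
    by (intro exI[of _ "insert f F"]) (auto intro: desc.intros)
qed

lemma desc_child_exists: assumes "f \<in> desc r" "r \<in> carrier G" "f \<noteq> r" shows "child (lab f) (par f) f"
  using assms(1)
proof (cases rule: desc.cases)
  case (desc_step h s)
  then show ?thesis using child_par_lab by simp
qed (use assms in simp)

text \<open>A finite subtree is grown by adding its vertices in order of increasing length. The set built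
  so far then lies in the past of the edge that leads to the new vertex, so that the Markov property
  applies to each step.\<close>

lemma rooted_induct [consumes 2, case_names root step]:
  assumes "rooted r F" "r \<in> carrier G" "P {r}"
    and "\<And>F s h f. rooted r F \<Longrightarrow> child s h f \<Longrightarrow> h \<in> F \<Longrightarrow> f \<notin> F \<Longrightarrow> (\<And>x. x \<in> F \<Longrightarrow> len x \<le> len f) \<Longrightarrow>
       F \<subseteq> Past G S f h \<Longrightarrow> P F \<Longrightarrow> P (insert f F)"
  shows "P F"
  using assms(1)
proof (induction "card F" arbitrary: F rule: less_induct)
  case less
  show ?case
  proof (cases "F = {r}")
    case False
    have F: "finite F" "F \<noteq> {}" "F \<subseteq> desc r" using less(2) by (auto simp: rooted_def)
    define m where "m = Max (len ` F)"
    have "m \<in> len ` F" unfolding m_def using F by (intro Max_in) auto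
    then obtain f where f: "f \<in> F" "len f = m" by auto
    have le: "len h \<le> len f" if "h \<in> F" for h unfolding f(2) m_def using that F by auto
    have "f \<noteq> r"
    proof
      assume "f = r"
      moreover obtain k where "k \<in> F" "k \<noteq> r" using False F by auto
      ultimately show False using desc_len[of k r] le[of k] F by auto
    qed
    then have ch: "child (lab f) (par f) f"
      using f F assms(2) by (intro desc_child_exists[of f r]) auto
    have pne: "par h \<noteq> f" if "h \<in> F - {r}" for h
    proof -
      have "child (lab h) (par h) h"
        using that F assms(2) by (intro desc_child_exists[of h r]) auto
      then show ?thesis using le[of h] that unfolding child_def by auto
    qed
    have root: "rooted r (F - {f})" using less(2) pne \<open>f \<noteq> r\<close> unfolding rooted_def by auto
    have "par f \<in> F - {f}" using pne[of f] f \<open>f \<noteq> r\<close> less(2) by (auto simp: rooted_def)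
    moreover have "F - {f} \<subseteq> Past G S f (par f)"
      using shallow_in_Past[OF ch] le F desc_carrier[OF _ assms(2)] by auto
    moreover have "P (F - {f})" using less(1)[of "F - {f}"] root F f by (simp add: card_gt_0_iff)
    ultimately have "P (insert f (F - {f}))" using assms(4)[OF root ch] le by blast
    then show ?thesis using f by (simp add: insert_absorb)
  qed (simp add: assms(3))
qed

end

text \<open>Right multiplication is an automorphism of the Cayley graph of a group, while in a free
  semigroup it embeds the tree into a branch. Both are compatible with pasts, and this compatibility
  makes a translated Markov chain a Markov chain again.\<close>

locale shift_cayley_tree = left_cayley_tree +
  assumes Past_shift: "\<lbrakk>s \<in> S; g \<in> carrier G; t \<in> carrier G; f \<in> Past G S (s \<otimes> g) g\<rbrakk>
     \<Longrightarrow> f \<otimes> t \<in> Past G S (s \<otimes> g \<otimes> t) (g \<otimes> t)"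

section \<open>Families of discrete random variables\<close>

definition evt :: "'w measure \<Rightarrow> ('i \<Rightarrow> 'w \<Rightarrow> nat) \<Rightarrow> 'i \<Rightarrow> nat \<Rightarrow> 'w set" where
  "evt M Z f i = {w \<in> space M. Z f w = i}"

definition cyl :: "'w measure \<Rightarrow> ('i \<Rightarrow> 'w \<Rightarrow> nat) \<Rightarrow> 'i set \<Rightarrow> ('i \<Rightarrow> nat) \<Rightarrow> 'w set" where
  "cyl M Z F c = {w \<in> space M. \<forall>f\<in>F. Z f w = c f}"

definition sig :: "'w measure \<Rightarrow> ('i \<Rightarrow> 'w \<Rightarrow> nat) \<Rightarrow> 'i set \<Rightarrow> 'w set set" where
  "sig M Z Q = sigma_sets (space M) {evt M Z f i | f i. f \<in> Q}"

lemma evt_in_sig: "f \<in> Q \<Longrightarrow> evt M Z f i \<in> sig M Z Q"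
  unfolding sig_def by auto

lemma sigma_algebra_sig: "sigma_algebra (space M) (sig M Z Q)"
  unfolding sig_def by (rule sigma_algebra_sigma_sets) (auto simp: evt_def)

lemma space_in_sig: "space M \<in> sig M Z Q"
  unfolding sig_def by (rule sigma_sets_top)

lemma sig_Int: "A \<in> sig M Z Q \<Longrightarrow> B \<in> sig M Z Q \<Longrightarrow> A \<inter> B \<in> sig M Z Q"
proof -
  interpret sigma_algebra "space M" "sig M Z Q" by (rule sigma_algebra_sig)
  show "A \<in> sig M Z Q \<Longrightarrow> B \<in> sig M Z Q \<Longrightarrow> A \<inter> B \<in> sig M Z Q" by (rule Int)
qed

lemma sig_mono: "Q \<subseteq> Q' \<Longrightarrow> sig M Z Q \<subseteq> sig M Z Q'"
  unfolding sig_def by (rule sigma_sets_subseteq) auto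

lemma cyl_insert: "cyl M Z (insert f F) c = cyl M Z F c \<inter> evt M Z f (c f)"
  unfolding cyl_def evt_def by auto

lemma cyl_single: "cyl M Z {f} c = evt M Z f (c f)"
  unfolding cyl_def evt_def by auto

lemma cyl_subset_evt: "f \<in> F \<Longrightarrow> cyl M Z F c \<subseteq> evt M Z f (c f)"
  unfolding cyl_def evt_def by auto

lemma cyl_in_sig: assumes "finite F" "F \<subseteq> Q" shows "cyl M Z F c \<in> sig M Z Q"
  using assms
proof (induction F)
  case empty
  then show ?case using space_in_sig by (simp add: cyl_def)
next
  case (insert f F)
  then show ?case unfolding cyl_insert by (intro sig_Int evt_in_sig) auto
qed

locale nat_process = prob_space M for M :: "'w measure" +
  fixes Z :: "'i \<Rightarrow> 'w \<Rightarrow> nat" and I :: "'i set"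
  assumes Z_measurable: "f \<in> I \<Longrightarrow> Z f \<in> measurable M (count_space UNIV)"
begin

lemma evt_sets: "f \<in> I \<Longrightarrow> evt M Z f i \<in> sets M"
  unfolding evt_def using measurable_sets[OF Z_measurable, of f "{i}"]
  by (auto simp: vimage_def Int_def conj_commute)

lemma sig_sets: "Q \<subseteq> I \<Longrightarrow> sig M Z Q \<subseteq> sets M"
  unfolding sig_def by (rule sets.sigma_sets_subset) (auto intro!: evt_sets)

lemma cyl_sets: "finite F \<Longrightarrow> F \<subseteq> I \<Longrightarrow> cyl M Z F c \<in> sets M"
  using cyl_in_sig[of F I M Z c] sig_sets[of I] by blast

text \<open>Cylinders over a union-closed cofinal family of finite index sets, together with the empty
  set, are stable under intersection and generate the whole \<open>\<sigma>\<close>-algebra. The freedom in the family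
  makes cylinders over subtrees sufficient. Equality of the total masses follows by summing over the
  countably many cylinders over one index set.\<close>

lemma sig_eqI:
  assumes Q: "Q \<subseteq> I"
    and sets_N: "sets N1 = sets M" "sets N2 = sets M" and fin: "finite_measure N1"
    and fam: "\<And>F. F \<in> \<F> \<Longrightarrow> finite F \<and> F \<subseteq> Q" "\<And>F F'. F \<in> \<F> \<Longrightarrow> F' \<in> \<F> \<Longrightarrow> F \<union> F' \<in> \<F>"
    and cofinal: "\<And>f. f \<in> Q \<Longrightarrow> \<exists>F\<in>\<F>. f \<in> F" and ne: "\<F> \<noteq> {}"
    and eq: "\<And>F c. F \<in> \<F> \<Longrightarrow> emeasure N1 (cyl M Z F c) = emeasure N2 (cyl M Z F c)"
    and A: "A \<in> sig M Z Q"
  shows "emeasure N1 A = emeasure N2 A"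
proof -
  \<comment> \<open>The empty set is added for pairs of cylinders that prescribe different values.\<close>
  define C where "C = insert {} {cyl M Z F c | F c. F \<in> \<F>}"
  have C_sets: "B \<in> sets M" if "B \<in> C" for B
    using that Q fam(1) unfolding C_def by (auto intro!: cyl_sets)
  have union: "B = (\<Union>c\<in>{c\<in>PiE F (\<lambda>_. UNIV). c f \<in> R}. cyl M Z F c)"
    if "f \<in> F" "B = {w\<in>space M. Z f w \<in> R}" for f F B R
  proof -
    have "w \<in> cyl M Z F (restrict (\<lambda>f. Z f w) F)" if "w \<in> space M" for w
      using that unfolding cyl_def by auto
    then show ?thesis using that unfolding cyl_def by (auto intro!: exI[of _ "restrict (\<lambda>f. Z f _) F"])
  qed
  have count: "countable {c\<in>PiE F (\<lambda>_. UNIV :: nat set). c f \<in> R}" if "F \<in> \<F>" for F R f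
    by (rule countable_subset[OF _ countable_PiE[of F "\<lambda>_. UNIV"]]) (use fam(1)[OF that] in auto)
  have space: "emeasure N1 (space M) = emeasure N2 (space M)"
  proof -
    obtain F where F: "F \<in> \<F>" using ne by auto
    have sp: "space M = (\<Union>c\<in>PiE F (\<lambda>_. UNIV). cyl M Z F c)"
    proof -
      have "w \<in> cyl M Z F (restrict (\<lambda>f. Z f w) F)" if "w \<in> space M" for w
        using that unfolding cyl_def by auto
      then show ?thesis unfolding cyl_def by (auto intro!: bexI[of _ "restrict (\<lambda>f. Z f _) F"])
    qed
    have dis: "disjoint_family_on (cyl M Z F) (PiE F (\<lambda>_. UNIV))"
      unfolding disjoint_family_on_def cyl_def
      by (auto simp: fun_eq_iff PiE_iff extensional_def) metis
    have cnt: "countable (PiE F (\<lambda>_. UNIV :: nat set))"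
      by (rule countable_PiE) (use fam(1)[OF F] in auto)
    have cs: "cyl M Z F c \<in> sets M" for c using C_sets F unfolding C_def by auto
    have "emeasure N (\<Union>c\<in>PiE F (\<lambda>_. UNIV). cyl M Z F c)
        = (\<integral>\<^sup>+c. emeasure N (cyl M Z F c) \<partial>count_space (PiE F (\<lambda>_. UNIV)))"
      if "sets N = sets M" for N
      by (rule emeasure_UN_countable) (use that cs cnt dis in auto)
    then show ?thesis unfolding sp using sets_N eq[OF F] by simp
  qed
  have gen: "evt M Z f i \<in> sigma_sets (space M) C" if "f \<in> Q" for f i
  proof -
    obtain F where F: "F \<in> \<F>" "f \<in> F" using cofinal \<open>f \<in> Q\<close> by auto
    have "evt M Z f i = (\<Union>c\<in>{c\<in>PiE F (\<lambda>_. UNIV). c f \<in> {i}}. cyl M Z F c)"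
      by (rule union) (auto simp: F evt_def)
    also have "\<dots> \<in> sigma_sets (space M) C"
      by (rule sigma_sets_UNION) (use count[OF F(1), of f "{i}"] F in \<open>auto simp: C_def\<close>)
    finally show ?thesis .
  qed
  have sub: "sigma_sets (space M) C \<subseteq> sets M"
    by (rule sets.sigma_sets_subset) (use C_sets in auto)
  have int: "Int_stable C"
  proof (rule Int_stableI)
    fix A B assume "A \<in> C" "B \<in> C"
    show "A \<inter> B \<in> C"
    proof (cases "A \<inter> B = {}")
      case False
      then obtain F c F' c' where A: "A = cyl M Z F c" "F \<in> \<F>" and B: "B = cyl M Z F' c'" "F' \<in> \<F>"
        using \<open>A \<in> C\<close> \<open>B \<in> C\<close> unfolding C_def by auto
      have "A \<inter> B = cyl M Z (F \<union> F') (\<lambda>f. if f \<in> F then c f else c' f)"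
      proof -
        obtain w where "w \<in> cyl M Z F c" "w \<in> cyl M Z F' c'" using False A B by auto
        then have "c f = c' f" if "f \<in> F" "f \<in> F'" for f using that unfolding cyl_def by auto
        then show ?thesis unfolding A B cyl_def by auto
      qed
      then show ?thesis using fam(2)[OF A(2) B(2)] unfolding C_def by auto
    qed (simp add: C_def)
  qed
  have A': "A \<in> sigma_sets (space M) C"
    using A unfolding sig_def
    by (rule sigma_sets_mono[THEN subsetD, rotated]) (use gen in auto)
  have C_Pow: "C \<subseteq> Pow (space M)" using C_sets sets.sets_into_space by blast
  from int C_Pow A' show ?thesis
  proof (induction rule: sigma_sets_induct_disjoint)
    case (basic A)
    then show ?case using eq unfolding C_def by auto
  next
    case (compl A)
    have A: "A \<in> sets M" using compl(1) sub by auto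
    have fin1: "emeasure N1 A \<noteq> \<infinity>" using fin finite_measure.emeasure_finite by simp blast
    have "emeasure N (space M - A) = emeasure N (space M) - emeasure N A"
      if "sets N = sets M" "emeasure N A \<noteq> \<infinity>" for N
      using emeasure_compl[of A N] sets_eq_imp_space_eq[OF that(1)] that A by simp
    then show ?case using sets_N fin1 compl(2) space by metis
  next
    case (union A)
    have "range A \<subseteq> sets M" using union(2) sub by auto
    then show ?case using suminf_emeasure[of A N1] suminf_emeasure[of A N2] union(1,3) sets_N by simp
  qed simp
qed

end

lemma sets_PiM_sig:
  "sets (PiM I (\<lambda>_. count_space (UNIV :: nat set))) = sig (PiM I (\<lambda>_. count_space UNIV)) (\<lambda>f x. x f) I"
    (is "?L = ?R")
proof
  let ?\<Omega> = "space (PiM I (\<lambda>_. count_space (UNIV :: nat set)))"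
  show "?L \<subseteq> ?R"
    unfolding sets_PiM_single sig_def space_PiM
  proof (rule sigma_sets_mono, safe)
    fix i and A :: "nat set" assume i: "i \<in> I"
    have "{f \<in> I \<rightarrow>\<^sub>E space (count_space UNIV). f i \<in> A}
       = (\<Union>a\<in>A. evt (PiM I (\<lambda>_. count_space (UNIV :: nat set))) (\<lambda>f x. x f) i a)"
      unfolding evt_def by (auto simp: space_PiM)
    also have "\<dots> \<in> sigma_sets (I \<rightarrow>\<^sub>E space (count_space UNIV))
       {evt (PiM I (\<lambda>_. count_space (UNIV :: nat set))) (\<lambda>f x. x f) f i |f i. f \<in> I}"
      by (rule sigma_sets_UNION) (use i in auto)
    finally show "{f \<in> I \<rightarrow>\<^sub>E space (count_space UNIV). f i \<in> A} \<in> sigma_sets (I \<rightarrow>\<^sub>E space (count_space UNIV))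
       {evt (PiM I (\<lambda>_. count_space (UNIV :: nat set))) (\<lambda>f x. x f) f i |f i. f \<in> I}" .
  qed
  show "?R \<subseteq> ?L"
    unfolding sig_def
    by (rule sets.sigma_sets_subset) (auto simp: evt_def)
qed

lemma sets_eq_sig:
  assumes "sets N = sets (PiM I (\<lambda>_. count_space (UNIV :: nat set)))"
  shows "sets N = sig N (\<lambda>f x. x f) I"
  unfolding assms sets_PiM_sig sig_def evt_def sets_eq_imp_space_eq[OF assms] ..

lemma nat_process_PiM:
  assumes "prob_space N" "sets N = sets (PiM I (\<lambda>_. count_space (UNIV :: nat set)))"
  shows "nat_process N (\<lambda>f x. x f) I"
proof -
  interpret prob_space N by fact
  show ?thesis
    by standard (simp add: measurable_cong_sets[OF assms(2) refl])
qed

context nat_process begin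

definition law :: "('i \<Rightarrow> nat) measure" where
  "law = distr M (PiM I (\<lambda>_. count_space UNIV)) (\<lambda>w. \<lambda>f\<in>I. Z f w)"

lemma code_measurable: "(\<lambda>w. \<lambda>f\<in>I. Z f w) \<in> measurable M (PiM I (\<lambda>_. count_space UNIV))"
  by (rule measurable_restrict) (rule Z_measurable)

lemma sets_law: "sets law = sets (PiM I (\<lambda>_. count_space UNIV))"
  unfolding law_def by simp

lemma prob_space_law: "prob_space law"
  unfolding law_def by (rule prob_space_distr) (rule code_measurable)

lemma emeasure_law_cyl:
  assumes "finite F" "F \<subseteq> I"
  shows "emeasure law (cyl law (\<lambda>f x. x f) F c) = emeasure M (cyl M Z F c)"
proof -
  interpret L: nat_process law "\<lambda>f x. x f" I
    by (rule nat_process_PiM[OF prob_space_law sets_law])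
  have "(\<lambda>w. \<lambda>f\<in>I. Z f w) -` cyl law (\<lambda>f x. x f) F c \<inter> space M = cyl M Z F c"
    using assms measurable_space[OF code_measurable]
    by (auto simp: cyl_def law_def space_PiM)
  then show ?thesis
    using L.cyl_sets[OF assms, of c] emeasure_distr[OF code_measurable, of "cyl law (\<lambda>f x. x f) F c"]
    unfolding sets_law law_def[symmetric] by simp
qed

end

lemma law_eqI:
  assumes "prob_space N1" "sets N1 = sets (PiM I (\<lambda>_. count_space (UNIV :: nat set)))"
    "prob_space N2" "sets N2 = sets (PiM I (\<lambda>_. count_space (UNIV :: nat set)))"
    and fam: "\<And>F. F \<in> \<F> \<Longrightarrow> finite F \<and> F \<subseteq> I" "\<And>F F'. F \<in> \<F> \<Longrightarrow> F' \<in> \<F> \<Longrightarrow> F \<union> F' \<in> \<F>"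
    and cofinal: "\<And>f. f \<in> I \<Longrightarrow> \<exists>F\<in>\<F>. f \<in> F" and ne: "\<F> \<noteq> {}"
    and eq: "\<And>F c. F \<in> \<F> \<Longrightarrow> emeasure N1 (cyl N1 (\<lambda>f x. x f) F c) = emeasure N2 (cyl N2 (\<lambda>f x. x f) F c)"
  shows "N1 = N2"
proof (rule measure_eqI)
  show sets_eq: "sets N1 = sets N2" using assms by simp
  interpret nat_process N1 "\<lambda>f x. x f" I by (rule nat_process_PiM) fact+
  have sp: "space N1 = space N2" by (rule sets_eq_imp_space_eq) fact
  fix A assume "A \<in> sets N1"
  then have A: "A \<in> sig N1 (\<lambda>f x. x f) I"
    using sets_eq_sig[OF assms(2)] by simp
  show "emeasure N1 A = emeasure N2 A"
    by (rule sig_eqI[OF order_refl _ _ _ fam cofinal ne _ A])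
      (use sets_eq eq finite_measure_axioms in \<open>auto simp: cyl_def sp\<close>)
qed

section \<open>Markov chains indexed by the tree\<close>

context left_cayley_tree begin

text \<open>The Markov property without conditional expectations, for transition probabilities \<open>P\<close> that
  are given in advance. Null events put no constraint on \<open>P\<close>.\<close>

definition tree_markov :: "'w measure \<Rightarrow> ('g \<Rightarrow> 'w \<Rightarrow> nat) \<Rightarrow> ('g \<Rightarrow> nat \<Rightarrow> nat \<Rightarrow> real) \<Rightarrow> bool" where
  "tree_markov M Z P \<longleftrightarrow> (\<forall>s\<in>S. \<forall>g\<in>carrier G. \<forall>A\<in>sig M Z (Past G S (s \<otimes> g) g). \<forall>a b.
     measure M (A \<inter> evt M Z g a \<inter> evt M Z (s \<otimes> g) b) = measure M (A \<inter> evt M Z g a) * P s a b)"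

text \<open>Each new vertex of a growing subtree contributes one transition probability.\<close>

lemma tree_markov_cyl:
  assumes "nat_process M Z (carrier G)" "tree_markov M Z P" "\<And>a. measure M (evt M Z \<one> a) = p a" "rooted \<one> F"
  shows "measure M (cyl M Z F c) = p (c \<one>) * (\<Prod>f\<in>F - {\<one>}. P (lab f) (c (par f)) (c f))"
  using assms(4) one_closed
proof (induction rule: rooted_induct)
  case root
  then show ?case using assms(3) by (simp add: cyl_single)
next
  case (step F s h f)
  have f: "f = s \<otimes> h" "s \<in> S" "h \<in> carrier G" using step(2) by (auto simp: child_def)
  have F: "finite F" using step(1) by (auto simp: rooted_def)
  have "cyl M Z F c \<in> sig M Z (Past G S f h)" using step(6) F by (rule cyl_in_sig[rotated])
  then have "measure M (cyl M Z F c \<inter> evt M Z h (c h) \<inter> evt M Z f (c f))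
      = measure M (cyl M Z F c \<inter> evt M Z h (c h)) * P s (c h) (c f)"
    using assms(2) f unfolding tree_markov_def by blast
  moreover have "cyl M Z F c \<inter> evt M Z h (c h) = cyl M Z F c"
    using cyl_subset_evt[OF step(3), of M Z c] by blast
  moreover have "insert f F - {\<one>} = insert f (F - {\<one>})" using child_not_one[OF step(2)] by auto
  ultimately show ?case
    using step(4,7) F child_par_lab[OF step(2)] by (simp add: cyl_insert)
qed

text \<open>The law on \<open>nat\<close>-valued functions of the Markov chain with root distribution \<open>p\<close> and
  transition probabilities \<open>P\<close>, described by its finite-dimensional distributions.\<close>

definition weight_law where
  "weight_law p P N \<longleftrightarrow> prob_space N \<and> sets N = sets (PiM (carrier G) (\<lambda>_. count_space (UNIV :: nat set))) \<and>
    (\<forall>F c. rooted \<one> F \<longrightarrow> measure N (cyl N (\<lambda>f x. x f) F c)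
       = p (c \<one>) * (\<Prod>f\<in>F - {\<one>}. P (lab f) (c (par f)) (c f)))"

lemma weight_law_unique: assumes "weight_law p P N1" "weight_law p P N2" shows "N1 = N2"
proof (rule law_eqI[where I = "carrier G" and \<F> = "Collect (rooted \<one>)"])
  show "\<And>f. f \<in> carrier G \<Longrightarrow> \<exists>F\<in>Collect (rooted \<one>). f \<in> F" using rooted_hull desc_one by blast
  show "Collect (rooted \<one>) \<noteq> {}" using rooted_single by auto
  fix F c assume "F \<in> Collect (rooted \<one>)"
  then have "measure N1 (cyl N1 (\<lambda>f x. x f) F c) = measure N2 (cyl N2 (\<lambda>f x. x f) F c)"
    using assms unfolding weight_law_def by simp
  moreover have "finite_measure N1" "finite_measure N2" using assms unfolding weight_law_def
    by (auto simp: prob_space_def)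
  ultimately show "emeasure N1 (cyl N1 (\<lambda>f x. x f) F c) = emeasure N2 (cyl N2 (\<lambda>f x. x f) F c)"
    by (simp add: finite_measure.emeasure_eq_measure)
qed (use assms in \<open>auto simp: weight_law_def rooted_Un\<close>, auto simp: rooted_def desc_one)

lemma tree_markov_law:
  assumes "nat_process M Z (carrier G)" "tree_markov M Z P" "\<And>a. measure M (evt M Z \<one> a) = p a"
  shows "weight_law p P (nat_process.law M Z (carrier G))"
proof -
  interpret nat_process M Z "carrier G" by fact
  show ?thesis
    unfolding weight_law_def using prob_space_law sets_law emeasure_law_cyl tree_markov_cyl[OF assms]
    by (auto simp: measure_def rooted_def desc_one)
qed

end

text \<open>Since right multiplication respects pasts, a translated chain has the Markov property with the
  same transition probabilities. With uniqueness of the law this will give shift invariance.\<close>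

lemma (in shift_cayley_tree) tree_markov_shift:
  assumes "tree_markov M Z P" and t: "t \<in> carrier G"
  shows "tree_markov M (\<lambda>f. Z (f \<otimes> t)) P"
  unfolding tree_markov_def
proof safe
  fix s g A a b assume s: "s \<in> S" and g: "g \<in> carrier G" 
    and A: "A \<in> sig M (\<lambda>f. Z (f \<otimes> t)) (Past G S (s \<otimes> g) g)"
  have e: "evt M (\<lambda>f. Z (f \<otimes> t)) f i = evt M Z (f \<otimes> t) i" for f i by (simp add: evt_def)
  have "A \<in> sig M Z (Past G S (s \<otimes> g \<otimes> t) (g \<otimes> t))"
    using A unfolding sig_def e
    by (rule sigma_sets_subseteq[THEN subsetD, rotated]) (use Past_shift[OF s g t] in blast)
  then show "measure M (A \<inter> evt M (\<lambda>f. Z (f \<otimes> t)) g a \<inter> evt M (\<lambda>f. Z (f \<otimes> t)) (s \<otimes> g) b) =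
       measure M (A \<inter> evt M (\<lambda>f. Z (f \<otimes> t)) g a) * P s a b"
    using assms s g t unfolding tree_markov_def e by (simp add: m_assoc)
qed

section \<open>The Markov property of a process\<close>

definition label :: "('g, 'x) process \<Rightarrow> 'x \<Rightarrow> nat" where
  "label X x = (THE i. x \<in> atom X i)"

definition coord :: "('g, 'x) process \<Rightarrow> 'g \<Rightarrow> 'x \<Rightarrow> nat" where
  "coord X f x = label X (act X f x)"

locale cayley_process = left_cayley_tree +
  fixes X :: "('a, 'x) process"
  assumes X: "ordered_process G X"
begin

abbreviation "M \<equiv> msr X"

lemma standard: "standard_prob_space M"
  using X unfolding ordered_process_def by auto

sublocale prob_space M
  using X unfolding ordered_process_def standard_prob_space_def by auto

lemma act_measurable: "g \<in> carrier G \<Longrightarrow> act X g \<in> measurable M M"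
  and act_distr: "g \<in> carrier G \<Longrightarrow> distr M M (act X g) = M"
  and act_one: "x \<in> space M \<Longrightarrow> act X \<one> x = x"
  and act_mult: "g \<in> carrier G \<Longrightarrow> h \<in> carrier G \<Longrightarrow> x \<in> space M \<Longrightarrow>
    act X (g \<otimes> h) x = act X g (act X h x)"
  and atom_sets: "atom X i \<in> sets M"
  and atom_disjoint: "disjoint_family (atom X)"
  and atom_Un: "(\<Union>i. atom X i) = space M"
  using X unfolding ordered_process_def by auto

lemma act_space: "g \<in> carrier G \<Longrightarrow> x \<in> space M \<Longrightarrow> act X g x \<in> space M"
  using act_measurable by (rule measurable_space)

lemma label_iff: assumes "x \<in> space M" shows "label X x = i \<longleftrightarrow> x \<in> atom X i"
proof -
  have *: "i = j" if "x \<in> atom X i" "x \<in> atom X j" for i j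
    using that atom_disjoint unfolding disjoint_family_on_def by blast
  obtain i where "x \<in> atom X i" using assms atom_Un by auto
  then have "\<exists>!i. x \<in> atom X i" using * by auto
  then have "x \<in> atom X (label X x)" unfolding label_def by (rule theI')
  then show ?thesis using * by auto
qed

lemma label_measurable: "label X \<in> measurable M (count_space UNIV)"
proof (rule measurable_count_space_eq2_countable[THEN iffD2], safe)
  fix i
  have "label X -` {i} \<inter> space M = atom X i"
    using label_iff sets.sets_into_space[OF atom_sets[of i]] by auto
  then show "label X -` {i} \<inter> space M \<in> sets M" using atom_sets by simp
qed auto

sublocale nat_process M "coord X" "carrier G"
proof
  fix f assume "f \<in> carrier G"
  then have "label X \<circ> act X f \<in> measurable M (count_space UNIV)"
    using act_measurable label_measurable by (intro measurable_comp)
  then show "coord X f \<in> measurable M (count_space UNIV)"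
    unfolding coord_def comp_def .
qed

lemma translate_evt: "f \<in> carrier G \<Longrightarrow> translate X f i = evt M (coord X) f i"
  unfolding translate_def evt_def coord_def using label_iff[OF act_space, of f _ i] by auto

lemma translate_one: "translate X \<one> i = atom X i"
  unfolding translate_def using act_one sets.sets_into_space[OF atom_sets[of i]] by auto

lemma translate_sets: "f \<in> carrier G \<Longrightarrow> translate X f i \<in> sets M"
  using translate_evt evt_sets by simp

lemma space_join: "space (join X Q) = space M"
  unfolding join_def translate_def by (subst space_measure_of) auto

lemma sets_join: assumes "Q \<subseteq> carrier G" shows "sets (join X Q) = sig M (coord X) Q"
proof -
  have "{translate X f i |f i. f \<in> Q} = {evt M (coord X) f i |f i. f \<in> Q}"
    using assms translate_evt by blast
  then show ?thesis
    unfolding join_def sig_def by (subst sets_measure_of) (auto simp: evt_def)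
qed

lemma subalgebra_join: "Q \<subseteq> carrier G \<Longrightarrow> finite_measure_subalgebra M (join X Q)"
  by unfold_locales (auto simp: subalgebra_def space_join sets_join dest: sig_sets)

lemma measure_act:
  assumes "g \<in> carrier G" "A \<in> sets M"
  shows "measure M (act X g -` A \<inter> space M) = measure M A"
  using measure_distr[OF act_measurable[OF assms(1)], of A] act_distr[OF assms(1)] assms(2) by simp

definition joint :: "'a \<Rightarrow> nat \<Rightarrow> nat \<Rightarrow> real" where
  "joint s a b = measure M (atom X a \<inter> translate X s b)"

lemma measure_evt: "g \<in> carrier G \<Longrightarrow> measure M (evt M (coord X) g a) = measure M (atom X a)"
  using measure_act[OF _ atom_sets[of a], of g] translate_evt[of g a] unfolding translate_def by simp

lemma measure_evt_edge:
  assumes "s \<in> S" "g \<in> carrier G"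
  shows "measure M (evt M (coord X) g a \<inter> evt M (coord X) (s \<otimes> g) b) = joint s a b"
proof -
  have "evt M (coord X) g a \<inter> evt M (coord X) (s \<otimes> g) b = act X g -` (atom X a \<inter> translate X s b) \<inter> space M"
    using assms act_mult[of s g] act_space[of g]
    by (auto simp flip: translate_evt simp: translate_def)
  then show ?thesis
    using measure_act[OF assms(2), of "atom X a \<inter> translate X s b"] assms atom_sets translate_sets
    by (simp add: joint_def)
qed

text \<open>On the past \<open>\<sigma>\<close>-algebra the candidate \<open>P (coord X g x)\<close> is measurable, because \<open>g\<close> belongs to
  the past. An integral over an event of the past splits over the countably many values at \<open>g\<close>, on
  each of which the candidate is constant.\<close>

lemma cond_exp_eq_transition:
  assumes Q: "Q \<subseteq> carrier G" "g \<in> Q" and f: "f \<in> carrier G" and P: "\<And>a. 0 \<le> P a \<and> P a \<le> 1"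
    and E: "\<And>A a. A \<in> sig M (coord X) Q \<Longrightarrow>
      measure M (A \<inter> evt M (coord X) g a \<inter> evt M (coord X) f b) = measure M (A \<inter> evt M (coord X) g a) * P a"
  shows "AE x in M. real_cond_exp M (join X Q) (indicat_real (translate X f b)) x = P (coord X g x)"
proof -
  interpret F: finite_measure_subalgebra M "join X Q" by (rule subalgebra_join) fact
  have "coord X g \<in> measurable (join X Q) (count_space UNIV)"
  proof (rule measurable_count_space_eq2_countable[THEN iffD2], safe)
    fix i
    have "coord X g -` {i} \<inter> space (join X Q) = evt M (coord X) g i"
      unfolding space_join evt_def by auto
    then show "coord X g -` {i} \<inter> space (join X Q) \<in> sets (join X Q)"
      using evt_in_sig[OF Q(2)] by (simp add: sets_join[OF Q(1)])
  qed auto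
  then have meas: "(\<lambda>x. P (coord X g x)) \<in> borel_measurable (join X Q)"
    by (rule measurable_compose) simp
  then have measM: "(\<lambda>x. P (coord X g x)) \<in> borel_measurable M"
    by (rule measurable_from_subalg[OF F.subalg])
  have ev [measurable]: "evt M (coord X) f b \<in> sets M" "translate X f b \<in> sets M" 
    using evt_sets f translate_sets by auto
  have evg: "evt M (coord X) g a \<in> sets M" for a using evt_sets Q by auto
  show ?thesis
  proof (rule F.real_cond_exp_charact)
    show int_E: "integrable M (indicat_real (translate X f b))"
      using ev(2) by (simp add: emeasure_eq_measure)
    show int: "integrable M (\<lambda>x. P (coord X g x))"
      by (rule integrable_const_bound[of _ 1]) (use P measM in auto)
    fix A assume "A \<in> sets (join X Q)"
    then have A: "A \<in> sig M (coord X) Q" by (simp add: sets_join[OF Q(1)])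
    then have AM: "A \<in> sets M" using sig_sets Q(1) by auto
    let ?A = "\<lambda>a. A \<inter> evt M (coord X) g a"
    have A_Un: "A = (\<Union>a. ?A a)" using sets.sets_into_space[OF AM] by (auto simp: evt_def)
    have dis: "disjoint_family ?A" by (auto simp: disjoint_family_on_def evt_def)
    have setint: "set_integrable M (\<Union>a. ?A a) h" if "integrable M h" for h :: "'x \<Rightarrow> real"
      using integrable_mult_indicator[OF AM that] A_Un unfolding set_integrable_def by simp
    have sum: "set_lebesgue_integral M A h = (\<Sum>a. set_lebesgue_integral M (?A a) h)"
      if "integrable M h" for h :: "'x \<Rightarrow> real"
      by (subst A_Un, rule lebesgue_integral_countable_add)
        (use AM evg dis setint[OF that] in \<open>auto simp: disjoint_family_on_def\<close>)
    have "set_lebesgue_integral M (?A a) (indicat_real (translate X f b))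
        = set_lebesgue_integral M (?A a) (\<lambda>x. P (coord X g x))" for a
    proof -
      have "set_lebesgue_integral M (?A a) (indicat_real (translate X f b))
          = (\<integral>x. indicator (?A a \<inter> evt M (coord X) f b) x \<partial>M)"
        unfolding set_lebesgue_integral_def translate_evt[OF f]
        by (rule Bochner_Integration.integral_cong) (auto simp: indicator_def)
      also have "\<dots> = measure M (?A a) * P a" using E[OF A, of a] AM evg[of a] ev by simp
      also have "\<dots> = (\<integral>x. P a * indicator (?A a) x \<partial>M)" using AM evg[of a] by simp
      also have "\<dots> = set_lebesgue_integral M (?A a) (\<lambda>x. P (coord X g x))"
        unfolding set_lebesgue_integral_def
        by (rule Bochner_Integration.integral_cong) (auto simp: indicator_def evt_def)
      finally show ?thesis .
    qed
    then show "set_lebesgue_integral M A (indicat_real (translate X f b))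
        = set_lebesgue_integral M A (\<lambda>x. P (coord X g x))"
      using sum[OF int] sum[OF int_E] by simp
  qed (rule meas)
qed

lemma sig_single: assumes "A \<in> sig M (coord X) {g}"
  shows "A \<inter> evt M (coord X) g a = {} \<or> evt M (coord X) g a \<subseteq> A"
  using assms unfolding sig_def
proof induction
  case (Union B)
  then show ?case by blast
qed (auto simp: evt_def)

text \<open>All three conditional expectations in the definition of a Markov process are evaluated. The
  two that condition on a single vertex equal the transition probability in every process, so that
  the Markov property is a condition on the first one alone.\<close>

lemma markov_iff_tree_markov:
  assumes P: "\<And>s a b. 0 \<le> P s a b \<and> P s a b \<le> 1"
    and J: "\<And>s a b. s \<in> S \<Longrightarrow> joint s a b = measure M (atom X a) * P s a b"
  shows "markov_process G S X \<longleftrightarrow> tree_markov M (coord X) P"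
proof -
  have ce2: "AE x in M. real_cond_exp M (join X {g}) (indicat_real (translate X (s \<otimes> g) i)) x
        = P s (coord X g x) i" if "s \<in> S" "g \<in> carrier G" for s g i
  proof (rule cond_exp_eq_transition[where P = "\<lambda>a. P s a i"])
    fix A a assume A: "A \<in> sig M (coord X) {g}"
    show "measure M (A \<inter> evt M (coord X) g a \<inter> evt M (coord X) (s \<otimes> g) i) =
      measure M (A \<inter> evt M (coord X) g a) * P s a i"
      using sig_single[OF A, of a]
    proof
      assume "evt M (coord X) g a \<subseteq> A"
      then have "A \<inter> evt M (coord X) g a = evt M (coord X) g a" by auto
      then show ?thesis
        using measure_evt_edge[OF that] J[OF that(1)] measure_evt[OF that(2)] by simp
    qed simp
  qed (use P that in auto)
  \<comment> \<open>The conditional expectation at the identity is pulled back along \<open>act X g\<close>.\<close>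
  have ce3: "AE x in M. real_cond_exp M (join X {\<one>}) (indicat_real (translate X s i)) (act X g x)
        = P s (coord X g x) i" if "s \<in> S" "g \<in> carrier G" for s g i
  proof -
    have "AE x in distr M M (act X g). real_cond_exp M (join X {\<one>}) (indicat_real (translate X s i)) x
        = P s (coord X \<one> x) i"
      unfolding act_distr[OF that(2)] using ce2[OF that(1) one_closed, of i] that by simp
    then have "AE x in M. real_cond_exp M (join X {\<one>}) (indicat_real (translate X s i)) (act X g x)
        = P s (coord X \<one> (act X g x)) i"
      by (rule AE_distrD[OF act_measurable[OF that(2)]])
    then show ?thesis
      by (rule AE_mp) (auto simp: coord_def act_one act_space[OF that(2)] intro!: AE_I2)
  qed
  show ?thesis
  proof
    assume T: "tree_markov M (coord X) P"
    show "markov_process G S X"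
      unfolding markov_process_def
    proof (intro conjI ballI allI X)
      fix s g i assume s: "s \<in> S" and g: "g \<in> carrier G"
      have "AE x in M. real_cond_exp M (join X (Past G S (s \<otimes> g) g))
          (indicat_real (translate X (s \<otimes> g) i)) x = P s (coord X g x) i"
        by (rule cond_exp_eq_transition[where P = "\<lambda>a. P s a i"])
          (use P s g T Past_carrier self_in_Past in \<open>auto simp: tree_markov_def\<close>)
      then show "AE x in M. real_cond_exp M (join X (Past G S (s \<otimes> g) g))
          (indicat_real (translate X (s \<otimes> g) i)) x =
         real_cond_exp M (join X {g}) (indicat_real (translate X (s \<otimes> g) i)) x \<and>
         real_cond_exp M (join X {g}) (indicat_real (translate X (s \<otimes> g) i)) x =
         real_cond_exp M (join X {\<one>}) (indicat_real (translate X s i)) (act X g x)"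
        using ce2[OF s g, of i] ce3[OF s g, of i] by eventually_elim simp
    qed
  next
    assume Mk: "markov_process G S X"
    show "tree_markov M (coord X) P"
      unfolding tree_markov_def
    proof (intro ballI allI)
      fix s g A a b
      assume s: "s \<in> S" and g: "g \<in> carrier G" and A: "A \<in> sig M (coord X) (Past G S (s \<otimes> g) g)"
      let ?Q = "Past G S (s \<otimes> g) g" and ?E = "translate X (s \<otimes> g) b"
      let ?A = "A \<inter> evt M (coord X) g a"
      have Q: "?Q \<subseteq> carrier G" "g \<in> ?Q" using Past_carrier self_in_Past g by auto
      interpret F: finite_measure_subalgebra M "join X ?Q" by (rule subalgebra_join) (rule Q)
      have AQ: "?A \<in> sets (join X ?Q)" unfolding sets_join[OF Q(1)] by (intro sig_Int A evt_in_sig Q)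
      have AM: "?A \<in> sets M" using AQ sets_join[OF Q(1)] sig_sets[OF Q(1)] by auto
      have EM: "?E \<in> sets M" using translate_sets s g by auto
      have ae: "AE x in M. real_cond_exp M (join X ?Q) (indicat_real ?E) x = P s (coord X g x) b"
      proof -
        have "AE x in M. real_cond_exp M (join X ?Q) (indicat_real ?E) x
            = real_cond_exp M (join X {g}) (indicat_real ?E) x"
          using Mk s g unfolding markov_process_def by auto
        then show ?thesis using ce2[OF s g, of b] by eventually_elim simp
      qed
      have "measure M (?A \<inter> ?E) = (\<integral>x. indicator (?A \<inter> ?E) x \<partial>M)" using AM EM by simp
      also have "\<dots> = set_lebesgue_integral M ?A (indicat_real ?E)"
        unfolding set_lebesgue_integral_def
        by (rule Bochner_Integration.integral_cong) (auto simp: indicator_def)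
      also have "\<dots> = set_lebesgue_integral M ?A (real_cond_exp M (join X ?Q) (indicat_real ?E))"
        by (rule F.real_cond_exp_intA) (use AQ EM in \<open>auto simp: emeasure_eq_measure\<close>)
      also have "\<dots> = (\<integral>x. P s a b * indicator ?A x \<partial>M)"
        unfolding set_lebesgue_integral_def
      proof (rule integral_cong_AE)
        show "AE x in M. indicat_real ?A x *\<^sub>R real_cond_exp M (join X ?Q) (indicat_real ?E) x
          = P s a b * indicat_real ?A x"
          using ae by eventually_elim (auto simp: indicator_def evt_def)
      qed (use AM in auto)
      also have "\<dots> = measure M ?A * P s a b" using AM by simp
      finally show "measure M (?A \<inter> evt M (coord X) (s \<otimes> g) b) = measure M ?A * P s a b"
        using translate_evt s g by simp
    qed
  qed
qed

end

section \<open>Construction of the Markov chain\<close>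

context nat_process begin

text \<open>\<open>sig_eqI\<close> for the measures \<open>A \<mapsto> measure M (A \<inter> B1)\<close> and \<open>A \<mapsto> measure M (A \<inter> B2) * q\<close>: the form
  in which the Markov property is extended from cylinders to all events of the past.\<close>

lemma sig_eq_measure:
  assumes Q: "Q \<subseteq> I"
    and fam: "\<And>F. F \<in> \<F> \<Longrightarrow> finite F \<and> F \<subseteq> Q" "\<And>F F'. F \<in> \<F> \<Longrightarrow> F' \<in> \<F> \<Longrightarrow> F \<union> F' \<in> \<F>"
    and cofinal: "\<And>f. f \<in> Q \<Longrightarrow> \<exists>F\<in>\<F>. f \<in> F" and ne: "\<F> \<noteq> {}"
    and B: "B1 \<in> sets M" "B2 \<in> sets M" and q: "0 \<le> (q::real)"
    and eq: "\<And>F c. F \<in> \<F> \<Longrightarrow> measure M (cyl M Z F c \<inter> B1) = measure M (cyl M Z F c \<inter> B2) * q"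
    and A: "A \<in> sig M Z Q"
  shows "measure M (A \<inter> B1) = measure M (A \<inter> B2) * q"
proof -
  \<comment> \<open>The two sides as measures in \<open>A\<close>.\<close>
  define N1 where "N1 = density M (indicator B1)"
  define N2 where "N2 = scale_measure (ennreal q) (density M (indicator B2))"
  have N1: "emeasure N1 C = ennreal (measure M (C \<inter> B1))" if "C \<in> sets M" for C
    unfolding N1_def emeasure_restricted[OF B(1) that] by (simp add: emeasure_eq_measure Int_commute)
  have N2: "emeasure N2 C = ennreal (measure M (C \<inter> B2) * q)" if "C \<in> sets M" for C
    unfolding N2_def emeasure_scale_measure emeasure_restricted[OF B(2) that]
    using q by (simp add: emeasure_eq_measure Int_commute ennreal_mult' mult.commute)
  have fin: "finite_measure N1"
    by (rule finite_measureI) (use N1[of "space M"] in \<open>simp add: N1_def\<close>)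
  have "emeasure N1 A = emeasure N2 A"
  proof (rule sig_eqI[OF Q _ _ fin fam cofinal ne _ A])
    fix F c assume F: "F \<in> \<F>"
    then have "cyl M Z F c \<in> sets M" using fam(1)[OF F] Q by (intro cyl_sets) auto
    then show "emeasure N1 (cyl M Z F c) = emeasure N2 (cyl M Z F c)"
      using N1 N2 eq[OF F] by simp
  qed (auto simp: N1_def N2_def)
  then show ?thesis using N1[of A] N2[of A] A sig_sets[OF Q] q by (auto simp: subset_iff)
qed

lemma measure_evt_sums:
  assumes "A \<in> sets M" "g \<in> I"
  shows "(\<lambda>a. measure M (A \<inter> evt M Z g a)) sums measure M A"
proof -
  have "(\<Union>a. A \<inter> evt M Z g a) = A"
    using sets.sets_into_space[OF assms(1)] by (auto simp: evt_def)
  moreover have "disjoint_family (\<lambda>a. A \<inter> evt M Z g a)" by (auto simp: disjoint_family_on_def evt_def)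
  moreover have "range (\<lambda>a. A \<inter> evt M Z g a) \<subseteq> sets M" using assms evt_sets by auto
  ultimately show ?thesis using finite_measure_UNION[of "\<lambda>a. A \<inter> evt M Z g a"] by metis
qed

end

context left_cayley_tree begin

text \<open>The chain is driven by independent noise \<open>w (f, a)\<close>, the value at the vertex \<open>f\<close> in case its
  parent has the value \<open>a\<close>. The recursion follows the parents of \<open>f\<close>, and its first argument is the
  depth of \<open>f\<close>; at the root the noise is read at the dummy value \<open>0\<close>.\<close>

primrec noise_coord :: "nat \<Rightarrow> ('g \<times> nat \<Rightarrow> nat) \<Rightarrow> 'g \<Rightarrow> nat" where
  "noise_coord 0 w f = w (f, 0)"
| "noise_coord (Suc n) w f = w (f, noise_coord n w (par f))"

text \<open>Over a subtree, prescribing the values of the chain is the same as prescribing the noise at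
  one index for each vertex, because the value of the parent is prescribed as well. These indices
  are distinct, and independence gives the product.\<close>

lemma weight_law_exists:
  assumes root: "prob_space \<rho>" "sets \<rho> = UNIV"
    and kern: "\<And>s a. prob_space (\<kappa> s a)" "\<And>s a. sets (\<kappa> s a) = UNIV"
  shows "\<exists>N. weight_law (\<lambda>a. measure \<rho> {a}) (\<lambda>s a b. measure (\<kappa> s a) {b}) N"
proof -
  define K where "K = (\<lambda>(f, a). if f = \<one> then \<rho> else \<kappa> (lab f) a)"
  have K: "prob_space (K j)" "sets (K j) = UNIV" for j
    using root kern unfolding K_def by (auto split: prod.splits)
  have spK: "space (K j) = UNIV" for j using K(2)[of j] sets_eq_imp_space_eq[of "K j" "count_space UNIV"] by simp
  interpret product_prob_space K UNIV
    using K by (simp add: product_prob_space_def product_sigma_finite_def product_prob_space_axioms_def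
        prob_space_imp_sigma_finite)
  let ?M = "PiM UNIV K"
  define Z where "Z = (\<lambda>f w. noise_coord (len f) w f)"
  have eval: "(\<lambda>w. w j) \<in> measurable ?M (count_space UNIV)" for j
    using measurable_component_singleton[of j UNIV K] measurable_cong_sets[of ?M ?M "K j" "count_space UNIV"] K(2)
    by simp
  have "(\<lambda>w. noise_coord n w f) \<in> measurable ?M (count_space UNIV)" for n f
  proof (induction n arbitrary: f)
    case (Suc n)
    show ?case unfolding noise_coord.simps
      by (rule measurable_compose_countable[where f = "\<lambda>a w. w (f, a)", OF eval Suc])
  qed (simp add: eval)
  then interpret Zp: nat_process ?M Z "carrier G"
    by unfold_locales (simp add: Z_def)
  have Z_rec: "Z f w = w (f, if f = \<one> then 0 else Z (par f) w)" if "f \<in> carrier G" for f w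
  proof (cases "f = \<one>")
    case False
    then have "len f = Suc (len (par f))" using par_lab[OF that False] by (simp add: child_def)
    then show ?thesis using False by (simp add: Z_def)
  qed (simp add: Z_def)
  have "measure Zp.law (cyl Zp.law (\<lambda>f x. x f) F c) = measure \<rho> {c \<one>} *
      (\<Prod>f\<in>F - {\<one>}. measure (\<kappa> (lab f) (c (par f))) {c f})" if F: "rooted \<one> F" for F c
  proof -
    have Fc: "F \<subseteq> carrier G" "finite F" "\<one> \<in> F" using F by (auto simp: rooted_def desc_one)
    \<comment> \<open>The index at which the noise is read if the chain takes the values \<open>c\<close>.\<close>
    define j where "j = (\<lambda>f. (f, if f = \<one> then 0 else c (par f)))"
    have noise_Z: "Z f w = c f" if "\<forall>f\<in>F. w (j f) = c f" "f \<in> F" for w f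
      using that(2)
    proof (induction "len f" arbitrary: f rule: less_induct)
      case (less f)
      show ?case
      proof (cases "f = \<one>")
        case False
        then have "par f \<in> F" using less(2) F by (auto simp: rooted_def)
        moreover have "len (par f) < len f"
          using par_lab[of f] less(2) False Fc by (auto simp: child_def)
        ultimately have "Z (par f) w = c (par f)" using less by auto
        then show ?thesis using Z_rec[of f w] less(2) Fc bspec[OF that(1) less(2)] False by (auto simp: j_def)
      qed (use Z_rec[of f w] less(2) Fc bspec[OF that(1) less(2)] in \<open>auto simp: j_def\<close>)
    qed
    have Z_noise: "w (j f) = c f" if "\<forall>f\<in>F. Z f w = c f" "f \<in> F" for w f
    proof -
      have "par f \<in> F" if "f \<noteq> \<one>" using \<open>f \<in> F\<close> F that by (auto simp: rooted_def)
      then show ?thesis using Z_rec[of f w] that Fc by (auto simp: j_def)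
    qed
    have fst_j: "fst (j f) = f" for f by (simp add: j_def)
    have noise_iff: "(\<forall>f\<in>F. Z f w = c f) \<longleftrightarrow> (\<forall>f\<in>F. w (j f) = c f)" for w
      using noise_Z Z_noise by metis
    have "cyl ?M Z F c = {w. \<forall>f\<in>F. w (j f) = c f}"
      unfolding cyl_def space_PiM spK noise_iff by (simp add: PiE_UNIV_domain)
    also have "\<dots> = prod_emb UNIV K (j ` F) (PiE (j ` F) (\<lambda>i. {c (fst i)}))"
      unfolding prod_emb_def space_PiM spK
      by (auto simp: fst_j restrict_def PiE_iff extensional_def)
    finally have "emeasure ?M (cyl ?M Z F c) = (\<Prod>i\<in>j ` F. emeasure (K i) {c (fst i)})"
      using emeasure_PiM_emb[of "j ` F" "\<lambda>i. {c (fst i)}"] Fc K(2) by simp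
    also have "\<dots> = (\<Prod>f\<in>F. emeasure (K (j f)) {c f})"
      by (subst prod.reindex) (auto simp: j_def inj_on_def)
    also have "\<dots> = (\<Prod>f\<in>F. ennreal (measure (K (j f)) {c f}))"
      by (simp add: finite_measure.emeasure_eq_measure[OF prob_space.finite_measure[OF K(1)]])
    also have "\<dots> = ennreal (\<Prod>f\<in>F. measure (K (j f)) {c f})"
      by (simp add: prod_ennreal)
    also have "(\<Prod>f\<in>F. measure (K (j f)) {c f}) = measure (K (j \<one>)) {c \<one>} * (\<Prod>f\<in>F - {\<one>}. measure (K (j f)) {c f})"
      using Fc by (subst prod.remove[of F \<one>]) auto
    also have "(\<Prod>f\<in>F - {\<one>}. measure (K (j f)) {c f}) = (\<Prod>f\<in>F - {\<one>}. measure (\<kappa> (lab f) (c (par f))) {c f})"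
      by (rule prod.cong) (auto simp: j_def K_def)
    finally have "emeasure ?M (cyl ?M Z F c) = ennreal (measure \<rho> {c \<one>} *
      (\<Prod>f\<in>F - {\<one>}. measure (\<kappa> (lab f) (c (par f))) {c f}))" by (simp add: j_def K_def)
    then show ?thesis using Zp.emeasure_law_cyl[OF Fc(2,1), of c]
      by (simp add: measure_def prod_nonneg)
  qed
  then have "weight_law (\<lambda>a. measure \<rho> {a}) (\<lambda>s a b. measure (\<kappa> s a) {b}) Zp.law"
    unfolding weight_law_def using Zp.prob_space_law Zp.sets_law by blast
  then show ?thesis by blast
qed

text \<open>The properties of \<open>p\<close> and \<open>P\<close> that come from an action: \<open>p\<close> is stationary for every generator,
  and reading an edge backwards gives the same joint distribution.\<close>

definition consistent :: "(nat \<Rightarrow> real) \<Rightarrow> ('g \<Rightarrow> nat \<Rightarrow> nat \<Rightarrow> real) \<Rightarrow> bool" where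
  "consistent p P \<longleftrightarrow> (\<forall>s a b. 0 \<le> P s a b \<and> P s a b \<le> 1) \<and>
     (\<forall>s\<in>S. \<forall>b. (\<lambda>a. p a * P s a b) sums p b) \<and>
     (\<forall>s\<in>S. \<forall>s'\<in>S. s' \<otimes> s = \<one> \<longrightarrow> (\<forall>a b. p b * P s' b a = p a * P s a b))"

text \<open>For an edge leading away from the root, the product formula contains the transition along this
  edge as a factor. Stationarity then yields the distribution at every vertex. For an edge from \<open>g\<close>
  towards the root, to \<open>h\<close>, the past is contained in the branch above \<open>g\<close>. Growing a subtree of this
  branch multiplies its probability by the same factors with and without the condition at \<open>h\<close>, and
  so everything reduces to the two vertices \<open>g\<close> and \<open>h\<close>, where reversibility applies.\<close>

lemma weight_law_markov:
  assumes N: "weight_law p P N" and cons: "consistent p P"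
  shows "tree_markov N (\<lambda>f x. x f) P" "\<And>g a. g \<in> carrier G \<Longrightarrow> measure N (evt N (\<lambda>f x. x f) g a) = p a"
proof -
  let ?Z = "\<lambda>(f::'g) x. x f :: nat"
  have prob: "prob_space N" and sets: "sets N = sets (PiM (carrier G) (\<lambda>_. count_space (UNIV :: nat set)))"
    and fidi: "\<And>F c. rooted \<one> F \<Longrightarrow> measure N (cyl N ?Z F c)
       = p (c \<one>) * (\<Prod>f\<in>F - {\<one>}. P (lab f) (c (par f)) (c f))"
    using N by (auto simp: weight_law_def)
  interpret nat_process N ?Z "carrier G" by (rule nat_process_PiM) fact+
  have P: "0 \<le> P s a b" "s \<in> S \<Longrightarrow> (\<lambda>a. p a * P s a b) sums p b"
    "s \<in> S \<Longrightarrow> s' \<in> S \<Longrightarrow> s' \<otimes> s = \<one> \<Longrightarrow> p b * P s' b a = p a * P s a b" for s s' a b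
    using cons unfolding consistent_def by auto
  \<comment> \<open>The cylinders used here are those over subtrees that contain \<open>g\<close> and avoid the branch above \<open>k\<close>, so that adding \<open>k\<close> gives a subtree again.\<close>
  have up_edge: "measure N (A \<inter> evt N ?Z g a \<inter> evt N ?Z k b) = measure N (A \<inter> evt N ?Z g a) * P s a b"
    if ch: "child s g k" and A: "A \<in> sig N ?Z (Past G S k g)" for s g k A a b
  proof -
    \<comment> \<open>The hull of a vertex outside the branch stays outside, as its elements lie on the way to the root.\<close>
    let ?F = "{F. rooted \<one> F \<and> g \<in> F \<and> F \<inter> desc k = {}}"
    have cc: "s \<in> S" "g \<in> carrier G" "k \<in> carrier G" using child_carrier[OF ch] by auto
    have hull: "\<exists>F. rooted \<one> F \<and> f \<in> F \<and> F \<inter> desc k = {}" if f: "f \<in> carrier G" "f \<notin> desc k" for f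
    proof -
      obtain F where F: "rooted \<one> F" "f \<in> F" "\<forall>h\<in>F. f \<in> desc h"
        using rooted_hull[of f \<one>] f desc_one by auto
      then have "F \<inter> desc k = {}" using desc_trans f(2) by blast
      with F show ?thesis by auto
    qed
    obtain Fg where Fg: "Fg \<in> ?F" using hull[OF cc(2) parent_not_desc[OF ch]] by auto
    have "measure N (A \<inter> (evt N ?Z g a \<inter> evt N ?Z k b)) = measure N (A \<inter> evt N ?Z g a) * P s a b"
    proof (rule sig_eq_measure[of "Past G S k g" ?F])
      show "\<exists>F\<in>?F. f \<in> F" if f: "f \<in> Past G S k g" for f
      proof -
        obtain F where "rooted \<one> F \<and> f \<in> F \<and> F \<inter> desc k = {}" using hull[of f] f Past_child[OF ch] by blast
        then have "F \<union> Fg \<in> ?F" using Fg rooted_Un by auto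
        then show ?thesis using \<open>rooted \<one> F \<and> f \<in> F \<and> F \<inter> desc k = {}\<close> by blast
      qed
      show "?F \<noteq> {}" using Fg by auto
      fix F c assume F: "F \<in> ?F"
      then have kF: "k \<notin> F" using desc_base by auto
      have Ff: "finite F" "F \<subseteq> carrier G" using F by (auto simp: rooted_def desc_one)
      show "measure N (cyl N ?Z F c \<inter> (evt N ?Z g a \<inter> evt N ?Z k b)) = measure N (cyl N ?Z F c \<inter> evt N ?Z g a) * P s a b"
      proof (cases "c g = a")
        case True
        have "cyl N ?Z F c \<inter> (evt N ?Z g a \<inter> evt N ?Z k b) = cyl N ?Z (insert k F) (c(k := b))"
          using F True kF by (auto simp: cyl_def evt_def)
        moreover have "cyl N ?Z F c \<inter> evt N ?Z g a = cyl N ?Z F c"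
          using F True by (auto simp: cyl_def evt_def)
        moreover have "rooted \<one> (insert k F)" using F rooted_insert[OF _ ch] by auto
        moreover have "insert k F - {\<one>} = insert k (F - {\<one>})" using child_not_one[OF ch] by auto
        moreover have "par f \<noteq> k" if "f \<in> F - {\<one>}" for f
          using F kF that by (auto simp: rooted_def)
        then have "(\<Prod>f\<in>F - {\<one>}. P (lab f) ((c(k := b)) (par f)) ((c(k := b)) f))
          = (\<Prod>f\<in>F - {\<one>}. P (lab f) (c (par f)) (c f))"
          using kF by (intro prod.cong) auto
        moreover have "par k = g" "lab k = s" "g \<noteq> k" "k \<noteq> \<one>"
          using child_par_lab[OF ch] child_not_one[OF ch] F kF by auto
        ultimately show ?thesis using F fidi[of "insert k F" "c(k := b)"] fidi[of F c] Ff kF True by simp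
      next
        case False
        then have "cyl N ?Z F c \<inter> evt N ?Z g a = {}" using F by (auto simp: cyl_def evt_def)
        then show ?thesis by (simp flip: Int_assoc)
      qed
    qed (use Past_child[OF ch] cc P(1) evt_sets A rooted_Un in
        \<open>auto simp: rooted_def desc_one\<close>)
    then show ?thesis by (simp add: Int_assoc)
  qed
  \<comment> \<open>The edge from the parent turns the distribution at the parent into the one at \<open>g\<close>.\<close>
  have marg: "measure N (evt N ?Z g a) = p a" if "g \<in> carrier G" for g a
    using that
  proof (induction "len g" arbitrary: g a)
    case 0
    then have "g = \<one>" using len_eq_0 by auto
    then show ?case using fidi[OF rooted_single, of "\<lambda>_. a"] by (simp add: cyl_single)
  next
    case (Suc n)
    then have ch: "child (lab g) (par g) g" by (intro par_lab) auto
    have "measure N (evt N ?Z g a \<inter> evt N ?Z (par g) b) = p b * P (lab g) b a" for b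
    proof -
      have "measure N (space N \<inter> evt N ?Z (par g) b \<inter> evt N ?Z g a) = measure N (space N \<inter> evt N ?Z (par g) b) * P (lab g) b a"
        by (rule up_edge[OF ch space_in_sig])
      moreover have "space N \<inter> evt N ?Z (par g) b = evt N ?Z (par g) b" by (auto simp: evt_def)
      moreover have "measure N (evt N ?Z (par g) b) = p b"
        using Suc(1)[of "par g" b] Suc(2) ch by (auto simp: child_def)
      ultimately show ?thesis by (simp add: Int_commute)
    qed
    then have "(\<lambda>b. p b * P (lab g) b a) sums measure N (evt N ?Z g a)"
      using measure_evt_sums[OF evt_sets, of g "par g" a] Suc(3) ch by (auto simp: child_def)
    then show ?case using P(2)[of "lab g" a] ch sums_unique2 by (auto simp: child_def)
  qed
  then show "\<And>g a. g \<in> carrier G \<Longrightarrow> measure N (evt N ?Z g a) = p a" .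
  \<comment> \<open>The past is replaced by the whole branch above \<open>g\<close>, explored from the root \<open>g\<close>.\<close>
  have down_edge: "measure N (A \<inter> evt N ?Z g a \<inter> evt N ?Z h b) = measure N (A \<inter> evt N ?Z g a) * P s a b"
    if ch: "child s' h g" and s: "s \<in> S" "s' \<otimes> s = \<one>" and A: "A \<in> sig N ?Z (desc g)" for s s' g h A a b
  proof -
    let ?F = "Collect (rooted g)"
    have cc: "s' \<in> S" "g \<in> carrier G" "h \<in> carrier G" using child_carrier[OF ch] by auto
    have hne: "h \<noteq> g" "len h < len g" using ch by (auto simp: child_def)
    have "measure N (A \<inter> (evt N ?Z g a \<inter> evt N ?Z h b)) = measure N (A \<inter> evt N ?Z g a) * P s a b"
    proof (rule sig_eq_measure[of "desc g" ?F])
      fix F c assume "F \<in> ?F"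
      then have "rooted g F" by simp
      then have *: "measure N (cyl N ?Z F c \<inter> evt N ?Z h b) = measure N (cyl N ?Z F c) * P s (c g) b"
        using cc(2)
      proof (induction rule: rooted_induct)
        case root
        have "measure N (space N \<inter> evt N ?Z h b \<inter> evt N ?Z g (c g)) = measure N (space N \<inter> evt N ?Z h b) * P s' b (c g)"
          by (rule up_edge[OF ch space_in_sig])
        moreover have "space N \<inter> evt N ?Z h b = evt N ?Z h b" by (auto simp: evt_def)
        ultimately have "measure N (evt N ?Z g (c g) \<inter> evt N ?Z h b) = p b * P s' b (c g)"
          using marg[OF cc(3)] by (simp add: Int_commute)
        then show ?case using P(3)[OF s(1) cc(1) s(2)] marg[OF cc(2)] by (simp add: cyl_single)
      next
        case (step F r q f)
        have gF: "g \<in> F" "finite F" using step(1) by (auto simp: rooted_def)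
        \<comment> \<open>The vertex \<open>h\<close> is nearer to the root than all of the branch, hence it joins the past of every step.\<close>
        have hP: "h \<in> Past G S f q"
          using step(5)[OF gF(1)] hne cc by (intro shallow_in_Past[OF step(2)]) auto
        have C: "cyl N ?Z F c \<in> sig N ?Z (Past G S f q)" using gF(2) step(6) by (rule cyl_in_sig)
        have C': "cyl N ?Z F c \<inter> evt N ?Z h b \<in> sig N ?Z (Past G S f q)"
          by (intro sig_Int C evt_in_sig hP)
        have q: "cyl N ?Z F c \<inter> evt N ?Z q (c q) = cyl N ?Z F c"
          using step(3) by (auto simp: cyl_def evt_def)
        have "measure N (cyl N ?Z (insert f F) c \<inter> evt N ?Z h b)
            = measure N (cyl N ?Z F c \<inter> evt N ?Z h b \<inter> evt N ?Z q (c q) \<inter> evt N ?Z f (c f))"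
          using q by (intro arg_cong[where f = "measure N"]) (auto simp: cyl_insert)
        also have "\<dots> = measure N (cyl N ?Z F c \<inter> evt N ?Z h b \<inter> evt N ?Z q (c q)) * P r (c q) (c f)"
          by (rule up_edge[OF step(2) C'])
        also have "cyl N ?Z F c \<inter> evt N ?Z h b \<inter> evt N ?Z q (c q) = cyl N ?Z F c \<inter> evt N ?Z h b"
          using q by auto
        also have "measure N (cyl N ?Z F c \<inter> evt N ?Z h b) * P r (c q) (c f)
           = measure N (cyl N ?Z F c \<inter> evt N ?Z q (c q)) * P r (c q) (c f) * P s (c g) b"
          unfolding step(7) q by simp
        also have "measure N (cyl N ?Z F c \<inter> evt N ?Z q (c q)) * P r (c q) (c f)
          = measure N (cyl N ?Z (insert f F) c)"
          using up_edge[OF step(2) C, of "c q" "c f"] unfolding q by (simp add: cyl_insert)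
        finally show ?case .
      qed
      have gF: "g \<in> F" using \<open>rooted g F\<close> by (simp add: rooted_def)
      show "measure N (cyl N ?Z F c \<inter> (evt N ?Z g a \<inter> evt N ?Z h b)) = measure N (cyl N ?Z F c \<inter> evt N ?Z g a) * P s a b"
      proof (cases "c g = a")
        case True
        then have "cyl N ?Z F c \<inter> evt N ?Z g a = cyl N ?Z F c"
          using gF by (auto simp: cyl_def evt_def)
        then show ?thesis using * True by (simp flip: Int_assoc)
      next
        case False
        then have "cyl N ?Z F c \<inter> evt N ?Z g a = {}" using gF by (auto simp: cyl_def evt_def)
        then show ?thesis by (simp flip: Int_assoc)
      qed
    next
      show "\<exists>F\<in>?F. f \<in> F" if "f \<in> desc g" for f using rooted_hull[OF that] by auto
    qed (use rooted_single cc P(1) evt_sets A rooted_Un desc_carrier in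
        \<open>auto simp: rooted_def\<close>)
    then show ?thesis by (simp add: Int_assoc)
  qed
  show "tree_markov N ?Z P"
    unfolding tree_markov_def
  proof (intro ballI allI)
    fix s g A a b assume s: "s \<in> S" and g: "g \<in> carrier G" and A: "A \<in> sig N ?Z (Past G S (s \<otimes> g) g)"
    show "measure N (A \<inter> evt N ?Z g a \<inter> evt N ?Z (s \<otimes> g) b) = measure N (A \<inter> evt N ?Z g a) * P s a b"
      using s g
    proof (cases rule: edge_cases)
      case up
      then show ?thesis using A by (rule up_edge)
    next
      case (down s')
      have "A \<in> sig N ?Z (desc g)" using A sig_mono[OF Past_parent[OF down(1)]] by blast
      then show ?thesis by (rule down_edge[OF down(1) s down(2)])
    qed
  qed
qed

end

section \<open>Recovering a point of a standard space from its code\<close>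

lemma pred_Bex_countable:
  assumes "countable X" "\<And>i. i \<in> X \<Longrightarrow> Measurable.pred M (P i)"
  shows "Measurable.pred M (\<lambda>x. \<exists>i\<in>X. P i x)"
proof -
  have "{x \<in> space M. \<exists>i\<in>X. P i x} = (\<Union>i\<in>X. {x \<in> space M. P i x})" by auto
  also have "\<dots> \<in> sets M" using assms by (intro sets.countable_UN') (auto simp: pred_def)
  finally show ?thesis by (simp add: pred_def)
qed

lemma pred_Ball_countable:
  assumes "countable X" "\<And>i. i \<in> X \<Longrightarrow> Measurable.pred M (P i)"
  shows "Measurable.pred M (\<lambda>x. \<forall>i\<in>X. P i x)"
proof -
  have "Measurable.pred M (\<lambda>x. \<not> (\<exists>i\<in>X. \<not> P i x))"
    by (intro pred_intros_logic pred_Bex_countable assms)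
  then show ?thesis by simp
qed

text \<open>If the preimages of measurable sets under \<open>\<kappa>\<close> exhaust the \<open>\<sigma>\<close>-algebra of a standard space
  modulo null sets, then \<open>\<kappa>\<close> has a measurable left inverse off a null set. For a countable base \<open>\<B>\<close>
  of the topology choose \<open>D V\<close> with \<open>\<kappa> -` D V = V\<close> modulo null sets. A point \<open>z\<close> determines the
  family of all \<open>V\<close> with \<open>z \<in> D V\<close>, and countably many conditions on \<open>z\<close> ensure that this is the
  family of all basic neighbourhoods of some point: completeness provides the point. This replaces
  the theorem of Lusin and Souslin on injective Borel images.\<close>

lemma measurable_left_inverse_mod_null:
  fixes M :: "'x measure" and N :: "'z measure"
  assumes M: "standard_prob_space M" and \<kappa>: "\<kappa> \<in> measurable M N"
    and gen: "\<And>B. B \<in> sets M \<Longrightarrow> \<exists>D\<in>sets N. (B - \<kappa> -` D \<inter> space M) \<union> (\<kappa> -` D \<inter> space M - B) \<in> null_sets M"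
  shows "\<exists>\<psi>\<in>measurable N M. \<exists>N0\<in>null_sets M. \<forall>x\<in>space M - N0. \<psi> (\<kappa> x) = x"
proof -
  obtain \<T> where \<T>: "topspace \<T> = space M" "completely_metrizable_space \<T>" "second_countable \<T>"
    and sets_M: "sets M = sigma_sets (space M) {V. openin \<T> V}"
    using M unfolding standard_prob_space_def by blast
  obtain S0 d where "Metric_space S0 d" "Metric_space.mcomplete S0 d" and \<T>_eq: "\<T> = Metric_space.mtopology S0 d"
    using \<T>(2) unfolding completely_metrizable_space_def by blast
  moreover have "S0 = space M"
    using \<T>(1) \<T>_eq \<open>Metric_space S0 d\<close> Metric_space.topspace_mtopology by metis
  ultimately interpret Metric_space "space M" d by simp
  have complete: "mcomplete" and \<T>_eq: "\<T> = mtopology"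
    using \<open>Metric_space.mcomplete S0 d\<close> \<T>_eq \<open>S0 = space M\<close> by auto
  obtain \<B> where \<B>: "countable \<B>" "\<And>V. V \<in> \<B> \<Longrightarrow> openin mtopology V"
    "\<And>U x. openin mtopology U \<Longrightarrow> x \<in> U \<Longrightarrow> \<exists>V\<in>\<B>. x \<in> V \<and> V \<subseteq> U"
    using \<T>(3) unfolding second_countable_def \<T>_eq by metis
  have \<B>_sets: "V \<in> sets M" if "V \<in> \<B>" for V
    unfolding sets_M \<T>_eq using \<B>(2)[OF that] by auto
  have \<B>_sub: "V \<subseteq> space M" if "V \<in> \<B>" for V
    using \<B>_sets[OF that] sets.sets_into_space by auto
  obtain D where D: "\<And>V. V \<in> \<B> \<Longrightarrow> D V \<in> sets N"
    "\<And>V. V \<in> \<B> \<Longrightarrow> (V - \<kappa> -` D V \<inter> space M) \<union> (\<kappa> -` D V \<inter> space M - V) \<in> null_sets M"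
    using gen \<B>_sets by metis
  define N0 where "N0 = (\<Union>V\<in>\<B>. (V - \<kappa> -` D V \<inter> space M) \<union> (\<kappa> -` D V \<inter> space M - V))"
  have N0: "N0 \<in> null_sets M" unfolding N0_def by (rule null_sets_UN') (use \<B>(1) D(2) in auto)
  have in_D: "x \<in> V \<longleftrightarrow> \<kappa> x \<in> D V" if "x \<in> space M - N0" "V \<in> \<B>" for x V
    using that unfolding N0_def by auto
  \<comment> \<open>Bound on the distances in \<open>V\<close>, so that sets \<open>V\<close> with \<open>z \<in> D V\<close> and growing \<open>k\<close> produce a Cauchy sequence.\<close>
  define small where "small = (\<lambda>k V. \<forall>x\<in>V. \<forall>y\<in>V. d x y < inverse (real (Suc k)))"
  \<comment> \<open>The sets \<open>V\<close> with \<open>z \<in> D V\<close> include arbitrarily small ones, any two meet, each contains the closure of another one, and they are closed under supersets in \<open>\<B>\<close>.\<close>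
  define Z where "Z = {z \<in> space N.
      (\<forall>k. \<exists>V\<in>{V\<in>\<B>. small k V}. z \<in> D V) \<and>
      (\<forall>U\<in>\<B>. \<forall>V\<in>{V\<in>\<B>. U \<inter> V = {}}. \<not> (z \<in> D U \<and> z \<in> D V)) \<and>
      (\<forall>V\<in>\<B>. z \<in> D V \<longrightarrow> (\<exists>W\<in>{W\<in>\<B>. mtopology closure_of W \<subseteq> V}. z \<in> D W)) \<and>
      (\<forall>U\<in>\<B>. \<forall>V\<in>{V\<in>\<B>. U \<subseteq> V}. z \<in> D U \<longrightarrow> z \<in> D V)}"
  have cnt: "countable {V\<in>\<B>. P V}" for P using \<B>(1) by simp
  have D': "Measurable.pred N (\<lambda>z. z \<in> D V)" if "V \<in> \<B>" for V
    using D(1)[OF that] by measurable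
  have Z: "Z \<in> sets N"
    unfolding Z_def pred_def[symmetric]
    by (intro pred_intros_logic pred_intros_countable pred_Ball_countable pred_Bex_countable \<B>(1) cnt)
      (use D' in auto)
  have \<kappa>_Z: "\<kappa> x \<in> Z" if x: "x \<in> space M - N0" for x
  proof -
    note [simp] = in_D[OF x, symmetric]
    have xM: "x \<in> space M" using x by simp
    have 1: "\<exists>V\<in>{V\<in>\<B>. small k V}. x \<in> V" for k
    proof -
      obtain V where V: "V \<in> \<B>" "x \<in> V" "V \<subseteq> mball x (inverse (real (Suc k)) / 2)"
        using \<B>(3)[of "mball x (inverse (real (Suc k)) / 2)" x] xM by auto
      have "d u v < inverse (real (Suc k))" if "u \<in> V" "v \<in> V" for u v
      proof -
        have "d x u < inverse (real (Suc k)) / 2" "d x v < inverse (real (Suc k)) / 2"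
          "u \<in> space M" "v \<in> space M" using V that by auto
        then show ?thesis using triangle'[of u x v] xM by (simp add: commute)
      qed
      then show ?thesis using V unfolding small_def by auto
    qed
    have 3: "\<exists>W\<in>{W\<in>\<B>. mtopology closure_of W \<subseteq> V}. x \<in> W" if V: "V \<in> \<B>" "x \<in> V" for V
    proof -
      obtain r where r: "r > 0" "mball x r \<subseteq> V" using \<B>(2)[OF V(1)] V(2) unfolding openin_mtopology by blast
      obtain W where W: "W \<in> \<B>" "x \<in> W" "W \<subseteq> mball x (r/2)"
        using \<B>(3)[of "mball x (r/2)" x] xM r by auto
      have "mtopology closure_of W \<subseteq> mcball x (r/2)"
        by (rule closure_of_minimal) (use W mball_subset_mcball in auto)
      also have "\<dots> \<subseteq> mball x r" using r by auto
      finally show ?thesis using W r by auto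
    qed
    show ?thesis
      unfolding Z_def using 1 3 x measurable_space[OF \<kappa>, of x] by (simp cong: bex_cong_simp conj_cong) blast
  qed
  have uniq: "x = y" if xy: "x \<in> space M" "y \<in> space M" "\<And>V. V \<in> \<B> \<Longrightarrow> x \<in> V \<longleftrightarrow> y \<in> V" for x y
  proof (rule ccontr)
    assume "x \<noteq> y"
    then have "0 < d x y" using xy by simp
    then obtain V where "V \<in> \<B>" "x \<in> V" "V \<subseteq> mball x (d x y)"
      using \<B>(3)[of "mball x (d x y)" x] xy(1) centre_in_mball_iff[of x "d x y"] by auto
    then show False using xy by auto
  qed
  have ex: "\<exists>x\<in>space M. \<forall>V\<in>\<B>. x \<in> V \<longleftrightarrow> z \<in> D V" if z: "z \<in> Z" for z
  proof -
    have "\<forall>k. \<exists>V. V \<in> \<B> \<and> small k V \<and> z \<in> D V"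
      using z unfolding Z_def by simp
    from choice[OF this] obtain V where V: "\<And>k. V k \<in> \<B>" "\<And>k. small k (V k)" "\<And>k. z \<in> D (V k)"
      by blast
    note Z234 = z[unfolded Z_def mem_Collect_eq, THEN conjunct2, THEN conjunct2]
    note Z2 = Z234[THEN conjunct1] and Z3 = Z234[THEN conjunct2, THEN conjunct1]
      and Z4 = Z234[THEN conjunct2, THEN conjunct2]
    have disj: "U \<inter> W \<noteq> {}" if "U \<in> \<B>" "W \<in> \<B>" "z \<in> D U" "z \<in> D W" for U W
      using bspec[OF bspec[OF Z2 that(1)], of W] that by blast
    have clo: "\<exists>W\<in>\<B>. mtopology closure_of W \<subseteq> U \<and> z \<in> D W" if "U \<in> \<B>" "z \<in> D U" for U
      using bspec[OF Z3 that(1)] that(2) by blast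
    have mono: "z \<in> D W" if "U \<in> \<B>" "W \<in> \<B>" "U \<subseteq> W" "z \<in> D U" for U W
      using bspec[OF bspec[OF Z4 that(1)], of W] that by blast
    define x where "x = (\<lambda>k. SOME y. y \<in> V k)"
    have x: "x k \<in> V k" for k
      unfolding x_def some_in_eq using disj[OF V(1) V(1) V(3) V(3), of k k] by simp
    have xM: "x k \<in> space M" for k using x \<B>_sub[OF V(1)] by auto
    have near: "d (x k) (x l) < inverse (real (Suc k)) + inverse (real (Suc l))" for k l
    proof -
      obtain y where y: "y \<in> V k" "y \<in> V l" using disj[OF V(1) V(1) V(3) V(3), of k l] by auto
      have "d (x k) y < inverse (real (Suc k))" "d y (x l) < inverse (real (Suc l))"
        using V(2) x y unfolding small_def by auto
      then show ?thesis using triangle[of "x k" y "x l"] xM y \<B>_sub[OF V(1)] by (smt (verit) subsetD)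
    qed
    have inv: "\<exists>N. \<forall>n\<ge>N. inverse (real (Suc n)) < e" if "e > 0" for e
      using LIMSEQ_inverse_real_of_nat that
      by (auto dest!: order_tendstoD(2)[where a = e] simp: eventually_sequentially)
    have "MCauchy x"
      unfolding MCauchy_def
    proof (intro conjI allI impI)
      fix e :: real assume "e > 0"
      then obtain K where "\<forall>n\<ge>K. inverse (real (Suc n)) < e/2" using inv[of "e/2"] by auto
      then have "d (x n) (x m) < e" if "K \<le> n" "K \<le> m" for n m
        using near[of n m] that by (smt (verit) field_sum_of_halves)
      then show "\<exists>K. \<forall>n n'. K \<le> n \<longrightarrow> K \<le> n' \<longrightarrow> d (x n) (x n') < e" by auto
    qed (use xM in auto)
    then obtain l where l: "limitin mtopology x l sequentially" using complete unfolding mcomplete_def by auto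
    then have lM: "l \<in> space M" using limitin_mspace by auto
    have close: "\<exists>k. V k \<subseteq> mball l e" if e: "e > 0" for e
    proof -
      obtain K1 where K1: "\<forall>n\<ge>K1. inverse (real (Suc n)) < e/2" using inv[of "e/2"] e by auto
      have "\<forall>\<^sub>F n in sequentially. x n \<in> space M \<and> d (x n) l < e/2"
        using l that unfolding limitin_metric by (meson half_gt_zero)
      then obtain K2 where K2: "\<forall>n\<ge>K2. d (x n) l < e/2" unfolding eventually_sequentially by auto
      define k where "k = max K1 K2"
      have "V k \<subseteq> mball l e"
      proof
        fix y assume y: "y \<in> V k"
        then have "d (x k) y < e/2" using V(2)[of k] x[of k] K1 unfolding small_def k_def
          by (smt (verit) max.cobounded1)
        moreover have "d (x k) l < e/2" using K2 unfolding k_def by simp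
        moreover have "y \<in> space M" using y \<B>_sub[OF V(1)] by auto
        ultimately show "y \<in> mball l e" using triangle'[of l "x k" y] lM xM
          by (auto simp: commute)
      qed
      then show ?thesis by blast
    qed
    have "l \<in> U \<longleftrightarrow> z \<in> D U" if U: "U \<in> \<B>" for U
    proof
      assume "z \<in> D U"
      then obtain W where W: "W \<in> \<B>" "mtopology closure_of W \<subseteq> U" "z \<in> D W" using clo U by auto
      have "l \<in> mtopology closure_of W"
        unfolding metric_closure_of
      proof (clarsimp simp: lM)
        fix r :: real assume "r > 0"
        then obtain k where "V k \<subseteq> mball l r" using close by auto
        moreover obtain y where "y \<in> V k" "y \<in> W" using disj[OF V(1) W(1) V(3) W(3), of k] by auto
        ultimately have "y \<in> W" "y \<in> mball l r" by blast+
        then show "\<exists>y\<in>W. y \<in> space M \<and> d l y < r" by (intro bexI[of _ y]) simp_all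
      qed
      then show "l \<in> U" using W by auto
    next
      assume "l \<in> U"
      then obtain r where "r > 0" "mball l r \<subseteq> U" using \<B>(2)[OF U] unfolding openin_mtopology by blast
      then obtain k where "V k \<subseteq> U" using close by blast
      then show "z \<in> D U" using mono[OF V(1) U _ V(3)] by auto
    qed
    then show ?thesis using lM by auto
  qed
  obtain \<psi>0 where \<psi>0: "\<And>z. z \<in> Z \<Longrightarrow> \<psi>0 z \<in> space M" "\<And>z V. z \<in> Z \<Longrightarrow> V \<in> \<B> \<Longrightarrow> \<psi>0 z \<in> V \<longleftrightarrow> z \<in> D V"
    using ex by metis
  obtain x0 where x0: "x0 \<in> space M"
    using M prob_space.not_empty unfolding standard_prob_space_def by blast
  define \<psi> where "\<psi> = (\<lambda>z. if z \<in> Z then \<psi>0 z else x0)"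
  have "\<psi> \<in> measurable N M"
  proof (rule measurable_sigma_sets[OF sets_M])
    fix U assume "U \<in> {V. openin \<T> V}"
    then have U: "openin mtopology U" using \<T>_eq by simp
    have "\<psi>0 z \<in> U \<longleftrightarrow> (\<exists>V\<in>{V\<in>\<B>. V \<subseteq> U}. z \<in> D V)" if "z \<in> Z" for z
      using \<B>(3)[OF U] \<psi>0(2)[OF that] by auto blast+
    then have "\<psi> -` U \<inter> space N = Z \<inter> (\<Union>V\<in>{V\<in>\<B>. V \<subseteq> U}. D V) \<union> (if x0 \<in> U then space N - Z else {})"
      using sets.sets_into_space[OF Z] unfolding \<psi>_def by (auto split: if_splits)
    also have "\<dots> \<in> sets N"
    proof -
      have "(\<Union>V\<in>{V\<in>\<B>. V \<subseteq> U}. D V) \<in> sets N"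
        by (rule sets.countable_UN'[OF cnt]) (use D(1) in auto)
      then show ?thesis using Z by auto
    qed
    finally show "\<psi> -` U \<inter> space N \<in> sets N" .
  next
    show "{V. openin \<T> V} \<subseteq> Pow (space M)" using openin_subset[of \<T>] \<T>(1) by auto
  qed (use x0 \<psi>0(1) in \<open>auto simp: \<psi>_def\<close>)
  moreover have "\<psi> (\<kappa> x) = x" if "x \<in> space M - N0" for x
    using \<kappa>_Z[OF that] uniq[of "\<psi>0 (\<kappa> x)" x] \<psi>0[of "\<kappa> x"] in_D[OF that] that by (auto simp: \<psi>_def)
  ultimately show ?thesis using N0 by blast
qed


context cayley_process begin

text \<open>The symbolic name of a point, in the space of sequences that carries the law.\<close>

definition code :: "'x \<Rightarrow> 'a \<Rightarrow> nat" where
  "code x = (\<lambda>g\<in>carrier G. coord X g x)"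

lemma code_measurable: "code \<in> measurable M law"
  using code_measurable unfolding code_def[abs_def] by (simp add: measurable_cong_sets[OF refl sets_law])

lemma distr_code: "distr M law code = law"
  unfolding law_def code_def[abs_def] by (rule distr_cong) auto

lemma code_vimage:
  assumes "C \<in> sig M (coord X) (carrier G)"
  shows "\<exists>D\<in>sets law. C = code -` D \<inter> space M"
  using assms unfolding sig_def
proof induction
  case (Basic a)
  then obtain f i where a: "f \<in> carrier G" "a = evt M (coord X) f i" by auto
  interpret L: nat_process law "\<lambda>f x. x f" "carrier G"
    by (rule nat_process_PiM[OF prob_space_law sets_law])
  have "a = code -` evt law (\<lambda>f x. x f) f i \<inter> space M"
    using a measurable_space[OF code_measurable] by (auto simp: evt_def code_def)
  then show ?case using L.evt_sets[OF a(1)] by auto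
next
  case Empty
  then show ?case by (intro bexI[of _ "{}"]) auto
next
  case (Compl a)
  then obtain D where D: "D \<in> sets law" "a = code -` D \<inter> space M" by auto
  have "space M - a = code -` (space law - D) \<inter> space M"
    using D(2) measurable_space[OF code_measurable] by auto
  then show ?case using D(1) by auto
next
  case (Union a)
  then obtain D where D: "\<And>i. D i \<in> sets law" "\<And>i. a i = code -` D i \<inter> space M" by metis
  have "(\<Union>i. a i) = code -` (\<Union>i. D i) \<inter> space M" unfolding D(2) by auto
  then show ?case using D(1) by (intro bexI[of _ "\<Union>i. D i"]) auto
qed

definition shift :: "'a \<Rightarrow> ('a \<Rightarrow> nat) \<Rightarrow> 'a \<Rightarrow> nat" where
  "shift g z = (\<lambda>f\<in>carrier G. z (f \<otimes> g))"

lemma code_act: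
  assumes "g \<in> carrier G" "x \<in> space M"
  shows "code (act X g x) = shift g (code x)"
  using assms by (auto simp: code_def shift_def coord_def act_mult fun_eq_iff restrict_def)

lemma atom_code: assumes "x \<in> space M" shows "x \<in> atom X i \<longleftrightarrow> code x \<one> = i"
  using assms by (simp add: code_def coord_def act_one label_iff)

text \<open>The exceptional null set is enlarged to contain all points whose orbit meets it, so that its
  complement is invariant. The image of the complement under \<open>code\<close> is measurable, as it consists of
  the names that decode to a point with this name.\<close>

lemma code_invertible:
  assumes "generating G X"
  obtains X' \<psi> W where
    "X' \<in> sets M" "space M - X' \<in> null_sets M" "\<And>g x. g \<in> carrier G \<Longrightarrow> x \<in> X' \<Longrightarrow> act X g x \<in> X'"
    "\<psi> \<in> measurable law M" "W \<in> sets law" "code ` X' = W"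
    "\<And>x. x \<in> X' \<Longrightarrow> \<psi> (code x) = x"
proof -
  have "\<exists>D\<in>sets law. (B - code -` D \<inter> space M) \<union> (code -` D \<inter> space M - B) \<in> null_sets M"
    if B: "B \<in> sets M" for B
  proof -
    obtain C where "C \<in> sets (join X (carrier G))" "(B - C) \<union> (C - B) \<in> null_sets M"
      using assms B unfolding generating_def by blast
    then show ?thesis using code_vimage[of C] by (auto simp: sets_join)
  qed
  then obtain \<psi> N0 where \<psi>: "\<psi> \<in> measurable law M" and N0: "N0 \<in> null_sets M"
    and inv: "\<forall>x\<in>space M - N0. \<psi> (code x) = x"
    using measurable_left_inverse_mod_null[OF standard code_measurable] by blast
  define X' where "X' = {x \<in> space M. \<forall>g\<in>carrier G. act X g x \<notin> N0}"
  define W where "W = {z \<in> space law. \<psi> z \<in> X' \<and> (\<forall>g\<in>carrier G. coord X g (\<psi> z) = z g)}"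
  have N0_sets: "N0 \<in> sets M" using N0 by auto
  have null: "space M - X' \<in> null_sets M"
  proof -
    have "act X g -` N0 \<inter> space M \<in> null_sets M" if "g \<in> carrier G" for g
      using measure_act[OF that N0_sets] measurable_sets[OF act_measurable[OF that] N0_sets] N0
      by (auto simp: null_sets_def emeasure_eq_measure)
    then have "(\<Union>g\<in>carrier G. act X g -` N0 \<inter> space M) \<in> null_sets M"
      by (intro null_sets_UN' carrier_countable) auto
    also have "(\<Union>g\<in>carrier G. act X g -` N0 \<inter> space M) = space M - X'" unfolding X'_def by auto
    finally show ?thesis .
  qed
  have X'_sets: "X' \<in> sets M"
  proof -
    have "space M - (space M - X') \<in> sets M" using null by blast
    moreover have "space M - (space M - X') = X'" unfolding X'_def by auto
    ultimately show ?thesis by simp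
  qed
  have inv': "\<psi> (code x) = x" if "x \<in> X'" for x
  proof -
    have "act X \<one> x \<notin> N0" using that unfolding X'_def by blast
    then show ?thesis using that inv act_one[of x] unfolding X'_def by simp
  qed
  have W_sets: "W \<in> sets law"
  proof -
    have "Measurable.pred law (\<lambda>z. \<psi> z \<in> X')"
      using measurable_sets[OF \<psi> X'_sets] by (simp add: pred_def vimage_def Int_def conj_commute)
    moreover have "Measurable.pred law (\<lambda>z. coord X g (\<psi> z) = z g)" if "g \<in> carrier G" for g
    proof -
      have 1: "(\<lambda>z. coord X g (\<psi> z)) \<in> measurable law (count_space UNIV)"
        by (rule measurable_compose[OF \<psi> Z_measurable[OF that]])
      have 2: "(\<lambda>z. z g) \<in> measurable law (count_space UNIV)"
        using measurable_component_singleton[OF that, of "\<lambda>_. count_space UNIV"]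
        by (simp add: measurable_cong_sets[OF sets_law refl])
      show ?thesis using 1 2 by measurable
    qed
    ultimately show ?thesis unfolding W_def pred_def[symmetric]
      by (intro pred_intros_logic pred_Ball_countable carrier_countable)
  qed
  have "code ` X' = W"
  proof
    show "code ` X' \<subseteq> W"
    proof
      fix z assume "z \<in> code ` X'"
      then obtain x where x: "x \<in> X'" "z = code x" by auto
      then have "\<psi> z = x" using inv' by simp
      then show "z \<in> W" using x measurable_space[OF code_measurable, of x]
        unfolding W_def X'_def by (auto simp: code_def)
    qed
    show "W \<subseteq> code ` X'"
    proof
      fix z assume z: "z \<in> W"
      then have "z \<in> extensional (carrier G)"
        using sets_eq_imp_space_eq[OF sets_law] unfolding W_def by (auto simp: space_PiM PiE_def)
      then have "code (\<psi> z) = z"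
        using z unfolding W_def code_def by (auto simp: fun_eq_iff extensional_def)
      then show "z \<in> code ` X'" using z unfolding W_def by (metis (mono_tags, lifting) image_eqI mem_Collect_eq)
    qed
  qed
  moreover have "act X g x \<in> X'" if "g \<in> carrier G" "x \<in> X'" for g x
    using that act_space[of g x] unfolding X'_def by (auto simp flip: act_mult)
  ultimately show thesis using that X'_sets null \<psi> W_sets inv' by blast
qed

end

section \<open>Generating processes with the same law\<close>

text \<open>Both processes are identified, off null sets, with conull shift-invariant sets of names under
  the same law. The isomorphism decodes the name of a point of \<open>X1\<close> in \<open>X2\<close>, on the names that are
  shared.\<close>

lemma generating_same_law_isomorphic:
  fixes X1 :: "('g, 'a) process" and X2 :: "('g, 'b) process"
  assumes P1: "cayley_process G S len X1" and P2: "cayley_process G S len X2"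
    and gen: "generating G X1" "generating G X2"
    and law: "nat_process.law (msr X1) (coord X1) (carrier G) = nat_process.law (msr X2) (coord X2) (carrier G)"
  shows "process_isomorphic G X1 X2"
proof -
  interpret A: cayley_process G S len X1 by fact
  interpret B: cayley_process G S len X2 by fact
  have law: "A.law = B.law" by fact
  obtain X1' \<psi>1 W1 where 1: "X1' \<in> sets (msr X1)" "space (msr X1) - X1' \<in> null_sets (msr X1)"
    "\<And>g x. g \<in> carrier G \<Longrightarrow> x \<in> X1' \<Longrightarrow> act X1 g x \<in> X1'"
    "\<psi>1 \<in> measurable A.law (msr X1)" "W1 \<in> sets A.law" "A.code ` X1' = W1"
    "\<And>x. x \<in> X1' \<Longrightarrow> \<psi>1 (A.code x) = x"
    using A.code_invertible[OF gen(1)] by blast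
  obtain X2' \<psi>2 W2 where 2: "X2' \<in> sets (msr X2)" "space (msr X2) - X2' \<in> null_sets (msr X2)"
    "\<And>g x. g \<in> carrier G \<Longrightarrow> x \<in> X2' \<Longrightarrow> act X2 g x \<in> X2'"
    "\<psi>2 \<in> measurable A.law (msr X2)" "W2 \<in> sets A.law" "B.code ` X2' = W2"
    "\<And>x. x \<in> X2' \<Longrightarrow> \<psi>2 (B.code x) = x"
    using B.code_invertible[OF gen(2)] unfolding law by blast
  have code2: "B.code \<in> measurable (msr X2) A.law" unfolding law by (rule B.code_measurable)
  note code1 = A.code_measurable
  have emeas1: "emeasure A.law D = emeasure (msr X1) (A.code -` D \<inter> space (msr X1))" if "D \<in> sets A.law" for D
    using emeasure_distr[OF code1 that] A.distr_code by simp
  have emeas2: "emeasure A.law D = emeasure (msr X2) (B.code -` D \<inter> space (msr X2))" if "D \<in> sets A.law" for D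
    using emeasure_distr[OF code2 that] B.distr_code unfolding law by simp
  have sub1: "X1' \<subseteq> space (msr X1)" using 1(1) sets.sets_into_space by auto
  have sub2: "X2' \<subseteq> space (msr X2)" using 2(1) sets.sets_into_space by auto
  have W1_null: "space A.law - W1 \<in> null_sets A.law"
  proof -
    have "A.code -` (space A.law - W1) \<inter> space (msr X1) \<subseteq> space (msr X1) - X1'" using 1(6) by auto
    then have "emeasure (msr X1) (A.code -` (space A.law - W1) \<inter> space (msr X1)) \<le> emeasure (msr X1) (space (msr X1) - X1')"
      by (rule emeasure_mono) (use 1(1) in auto)
    then show ?thesis using 1(2,5) emeas1[of "space A.law - W1"] by (auto simp: null_sets_def)
  qed
  have W2_null: "space A.law - W2 \<in> null_sets A.law"
  proof -
    have "B.code -` (space A.law - W2) \<inter> space (msr X2) \<subseteq> space (msr X2) - X2'" using 2(6) by auto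
    then have "emeasure (msr X2) (B.code -` (space A.law - W2) \<inter> space (msr X2)) \<le> emeasure (msr X2) (space (msr X2) - X2')"
      by (rule emeasure_mono) (use 2(1) in auto)
    then show ?thesis using 2(2,5) emeas2[of "space A.law - W2"] by (auto simp: null_sets_def)
  qed
  define X0 where "X0 = A.code -` W2 \<inter> X1'"
  define Y0 where "Y0 = B.code -` W1 \<inter> X2'"
  define \<phi> where "\<phi> = (\<lambda>x. \<psi>2 (A.code x))"
  have X0_sets: "X0 \<in> sets (msr X1)"
  proof -
    have "X0 = (A.code -` W2 \<inter> space (msr X1)) \<inter> X1'" unfolding X0_def using sub1 by auto
    then show ?thesis using measurable_sets[OF code1 2(5)] 1(1) by auto
  qed
  have Y0_sets: "Y0 \<in> sets (msr X2)"
  proof -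
    have "Y0 = (B.code -` W1 \<inter> space (msr X2)) \<inter> X2'" unfolding Y0_def using sub2 by auto
    then show ?thesis using measurable_sets[OF code2 1(5)] 2(1) by auto
  qed
  have X0_null: "space (msr X1) - X0 \<in> null_sets (msr X1)"
  proof (rule null_sets_subset)
    show "(space (msr X1) - X1') \<union> (A.code -` (space A.law - W2) \<inter> space (msr X1)) \<in> null_sets (msr X1)"
      using 1(2) emeas1[of "space A.law - W2"] W2_null measurable_sets[OF code1, of "space A.law - W2"]
      by (intro null_sets.Un) (auto simp: null_sets_def)
    show "space (msr X1) - X0 \<subseteq> (space (msr X1) - X1') \<union> (A.code -` (space A.law - W2) \<inter> space (msr X1))"
      using measurable_space[OF code1] unfolding X0_def by auto
  qed (use X0_sets in auto)
  have Y0_null: "space (msr X2) - Y0 \<in> null_sets (msr X2)"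
  proof (rule null_sets_subset)
    show "(space (msr X2) - X2') \<union> (B.code -` (space A.law - W1) \<inter> space (msr X2)) \<in> null_sets (msr X2)"
      using 2(2) emeas2[of "space A.law - W1"] W1_null measurable_sets[OF code2, of "space A.law - W1"]
      by (intro null_sets.Un) (auto simp: null_sets_def)
    show "space (msr X2) - Y0 \<subseteq> (space (msr X2) - X2') \<union> (B.code -` (space A.law - W1) \<inter> space (msr X2))"
      using measurable_space[OF code2] unfolding Y0_def by auto
  qed (use Y0_sets in auto)
  have \<phi>1: "\<phi> x \<in> Y0 \<and> B.code (\<phi> x) = A.code x" if x: "x \<in> X0" for x
  proof -
    obtain y where y: "y \<in> X2'" "B.code y = A.code x" using x 2(6) unfolding X0_def by auto
    then have "\<phi> x = y" using 2(7) unfolding \<phi>_def by metis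
    then show ?thesis using y x 1(6) unfolding X0_def Y0_def by auto
  qed
  have \<phi>2: "\<psi>1 (B.code y) \<in> X0 \<and> \<phi> (\<psi>1 (B.code y)) = y" if y: "y \<in> Y0" for y
  proof -
    obtain x where x: "x \<in> X1'" "A.code x = B.code y" using y 1(6) unfolding Y0_def by auto
    then have "\<psi>1 (B.code y) = x" using 1(7) by metis
    then show ?thesis using y x 2(6,7) unfolding X0_def Y0_def \<phi>_def by auto
  qed
  have \<phi>3: "\<psi>1 (B.code (\<phi> x)) = x" if x: "x \<in> X0" for x
    using \<phi>1[OF x] 1(7) x unfolding X0_def by simp
  have bij: "bij_betw \<phi> X0 Y0"
    by (rule bij_betwI[where g = "\<lambda>y. \<psi>1 (B.code y)"]) (use \<phi>1 \<phi>2 \<phi>3 in auto)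
  have inv: "the_inv_into X0 \<phi> y = \<psi>1 (B.code y)" if "y \<in> Y0" for y
    using \<phi>2[OF that] bij by (intro the_inv_into_f_eq) (auto simp: bij_betw_def)
  have sp1: "space (restrict_space (msr X1) X0) = X0"
    using X0_sets by (simp add: space_restrict_space2)
  have sp2: "space (restrict_space (msr X2) Y0) = Y0"
    using Y0_sets by (simp add: space_restrict_space2)
  have "\<phi> \<in> measurable (msr X1) (msr X2)"
    unfolding \<phi>_def using measurable_compose[OF code1 2(4)] .
  then have \<phi>_meas: "\<phi> \<in> measurable (restrict_space (msr X1) X0) (restrict_space (msr X2) Y0)"
    by (intro measurable_restrict_space3) (use \<phi>1 in auto)
  have "(\<lambda>y. \<psi>1 (B.code y)) \<in> measurable (msr X2) (msr X1)"
    using measurable_compose[OF code2 1(4)] .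
  then have "(\<lambda>y. \<psi>1 (B.code y)) \<in> measurable (restrict_space (msr X2) Y0) (restrict_space (msr X1) X0)"
    by (intro measurable_restrict_space3) (use \<phi>2 in auto)
  then have inv_meas: "the_inv_into X0 \<phi> \<in> measurable (restrict_space (msr X2) Y0) (restrict_space (msr X1) X0)"
    by (subst measurable_cong[of _ _ "\<lambda>y. \<psi>1 (B.code y)"]) (use inv sp2 in auto)
  have dist: "distr (restrict_space (msr X1) X0) (restrict_space (msr X2) Y0) \<phi> = restrict_space (msr X2) Y0"
  proof (rule measure_eqI)
    fix C assume "C \<in> sets (distr (restrict_space (msr X1) X0) (restrict_space (msr X2) Y0) \<phi>)"
    then have C: "C \<in> sets (restrict_space (msr X2) Y0)" by simp
    then have C': "C \<subseteq> Y0" "C \<in> sets (msr X2)"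
      using sets_restrict_space_iff[of Y0 "msr X2" C] Y0_sets by auto
    let ?D = "\<psi>2 -` C \<inter> space A.law"
    have D: "?D \<in> sets A.law" using measurable_sets[OF 2(4) C'(2)] .
    have "emeasure (distr (restrict_space (msr X1) X0) (restrict_space (msr X2) Y0) \<phi>) C
      = emeasure (restrict_space (msr X1) X0) (\<phi> -` C \<inter> X0)"
      using emeasure_distr[OF \<phi>_meas C] sp1 by simp
    also have "\<dots> = emeasure (msr X1) (\<phi> -` C \<inter> X0)"
      using X0_sets by (intro emeasure_restrict_space) auto
    also have "\<phi> -` C \<inter> X0 = (A.code -` ?D \<inter> space (msr X1)) - (space (msr X1) - X0)"
      using measurable_space[OF code1] sets.sets_into_space[OF X0_sets] unfolding \<phi>_def by auto
    also have "emeasure (msr X1) \<dots> = emeasure (msr X1) (A.code -` ?D \<inter> space (msr X1))"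
      by (rule emeasure_Diff_null_set[OF X0_null measurable_sets[OF code1 D]])
    also have "\<dots> = emeasure (msr X2) (B.code -` ?D \<inter> space (msr X2))"
      using emeas1[OF D] emeas2[OF D] by simp
    also have "\<dots> = emeasure (msr X2) ((B.code -` ?D \<inter> space (msr X2)) - (space (msr X2) - Y0))"
      by (rule emeasure_Diff_null_set[OF Y0_null measurable_sets[OF code2 D], symmetric])
    also have "(B.code -` ?D \<inter> space (msr X2)) - (space (msr X2) - Y0) = C"
      using measurable_space[OF code2] sets.sets_into_space[OF Y0_sets] C'(1) 2(7) unfolding Y0_def by auto
    also have "emeasure (msr X2) C = emeasure (restrict_space (msr X2) Y0) C"
      using Y0_sets C' by (intro emeasure_restrict_space[symmetric]) auto
    finally show "emeasure (distr (restrict_space (msr X1) X0) (restrict_space (msr X2) Y0) \<phi>) C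
      = emeasure (restrict_space (msr X2) Y0) C" .
  qed simp
  have shift: "A.shift = B.shift" unfolding A.shift_def[abs_def] B.shift_def[abs_def] ..
  have equi: "act X1 g x \<in> X0 \<and> \<phi> (act X1 g x) = act X2 g (\<phi> x)" if g: "g \<in> carrier G" and x: "x \<in> X0" for g x
  proof -
    have xs: "x \<in> X1'" "x \<in> space (msr X1)" using x sub1 unfolding X0_def by auto
    have ys: "\<phi> x \<in> X2'" "\<phi> x \<in> space (msr X2)" using \<phi>1[OF x] sub2 unfolding Y0_def by auto
    have eq: "A.code (act X1 g x) = B.code (act X2 g (\<phi> x))"
      using A.code_act[OF g xs(2)] B.code_act[OF g ys(2)] \<phi>1[OF x] shift by simp
    have in2: "act X2 g (\<phi> x) \<in> X2'" by (rule 2(3)[OF g ys(1)])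
    have in0: "act X1 g x \<in> X0" using 1(3)[OF g xs(1)] in2 2(6) eq unfolding X0_def by auto
    moreover have "\<phi> (act X1 g x) = act X2 g (\<phi> x)" using arg_cong[OF eq, of \<psi>2] 2(7)[OF in2] by (simp add: \<phi>_def)
    ultimately show ?thesis by simp
  qed
  have atoms: "\<phi> ` (atom X1 i \<inter> X0) = atom X2 i \<inter> Y0" for i
  proof -
    have iff: "x \<in> atom X1 i \<longleftrightarrow> \<phi> x \<in> atom X2 i" if x: "x \<in> X0" for x
      using A.atom_code[of x i] B.atom_code[of "\<phi> x" i] \<phi>1[OF x] x sub1 sub2 unfolding X0_def Y0_def by auto
    show ?thesis
    proof
      show "\<phi> ` (atom X1 i \<inter> X0) \<subseteq> atom X2 i \<inter> Y0" using iff \<phi>1 by auto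
      show "atom X2 i \<inter> Y0 \<subseteq> \<phi> ` (atom X1 i \<inter> X0)"
      proof
        fix y assume y: "y \<in> atom X2 i \<inter> Y0"
        then show "y \<in> \<phi> ` (atom X1 i \<inter> X0)"
          using \<phi>2[of y] iff[of "\<psi>1 (B.code y)"] by (intro image_eqI[of _ _ "\<psi>1 (B.code y)"]) auto
      qed
    qed
  qed
  show ?thesis
    unfolding process_isomorphic_def
    using X0_sets X0_null Y0_sets Y0_null bij \<phi>_meas inv_meas dist equi atoms by blast
qed

section \<open>The shift on sequences indexed by the tree\<close>

lemma standard_prob_space_sequences:
  assumes "countable I" "prob_space N" and sets: "sets N = sets (PiM I (\<lambda>_. count_space (UNIV :: nat set)))"
  shows "standard_prob_space N"
  unfolding standard_prob_space_def
proof (intro conjI exI)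
  let ?T = "product_topology (\<lambda>_. discrete_topology (UNIV :: nat set)) I"
  have sp: "space N = PiE I (\<lambda>_. UNIV)" using sets_eq_imp_space_eq[OF sets] by (simp add: space_PiM)
  show "prob_space N" by fact
  show "topspace ?T = space N" by (simp add: sp)
  show "completely_metrizable_space ?T"
    unfolding completely_metrizable_space_product_topology
    using assms(1) completely_metrizable_space_discrete_topology
    by (auto intro: countable_subset[of _ I])
  define \<B> where "\<B> = (\<lambda>(F, c). cyl N (\<lambda>f x. x f) F c) ` (SIGMA F : {F. finite F \<and> F \<subseteq> I}. PiE F (\<lambda>_. UNIV))"
  have \<B>_count: "countable \<B>"
    unfolding \<B>_def
  proof (intro countable_image countable_SIGMA)
    show "countable {F. finite F \<and> F \<subseteq> I}" using countable_Collect_finite_subset[OF assms(1)] by simp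
  qed (auto intro: countable_PiE)
  have \<B>_open: "openin ?T V" if V_in: "V \<in> \<B>" for V
  proof -
    obtain F c where V: "finite F" "F \<subseteq> I" "V = cyl N (\<lambda>f x. x f) F c" using V_in unfolding \<B>_def by auto
    have "V = PiE I (\<lambda>f. if f \<in> F then {c f} else UNIV)"
      using V(2) unfolding V(3) cyl_def sp by (auto simp: PiE_iff extensional_def split: if_splits)
    moreover have "finite {i \<in> I. (if i \<in> F then {c i} else UNIV) \<noteq> (UNIV :: nat set)}"
      by (rule finite_subset[OF _ V(1)]) auto
    ultimately show ?thesis by (simp add: openin_PiE_gen)
  qed
  have \<B>_base: "\<exists>V\<in>\<B>. x \<in> V \<and> V \<subseteq> U" if U: "openin ?T U" and x: "x \<in> U" for U x
  proof -
    obtain R where R: "finite {i \<in> I. R i \<noteq> UNIV}" "x \<in> PiE I R" "PiE I R \<subseteq> U"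
      using U x unfolding openin_product_topology_alt by auto
    let ?F = "{i \<in> I. R i \<noteq> UNIV}"
    let ?V = "cyl N (\<lambda>f x. x f) ?F (restrict x ?F)"
    have V1: "?V \<in> \<B>"
      unfolding \<B>_def using R(1) by (intro image_eqI[of _ _ "(?F, restrict x ?F)"]) auto
    have V2: "x \<in> ?V"
      using R(2) unfolding cyl_def sp by (auto simp: PiE_iff)
    have V3: "?V \<subseteq> PiE I R"
    proof
      fix y assume y: "y \<in> ?V"
      have "y i \<in> R i" if "i \<in> I" for i
        using y R(2) that by (cases "R i = UNIV") (auto simp: cyl_def PiE_iff)
      then show "y \<in> PiE I R" using y by (auto simp: cyl_def sp PiE_iff)
    qed
    show ?thesis
      by (rule bexI[OF _ V1]) (intro conjI V2 subset_trans[OF V3 R(3)])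
  qed
  show "second_countable ?T"
    unfolding second_countable_def
    by (intro exI[of _ \<B>] conjI \<B>_count ballI \<B>_open allI impI) (auto intro: \<B>_base)
  show "sets N = sigma_sets (space N) {V. openin ?T V}"
  proof
    interpret nat_process N "\<lambda>f x. x f" I by (rule nat_process_PiM) fact+
    have \<B>_sets: "V \<in> sets N" if "V \<in> \<B>" for V
      using that cyl_sets unfolding \<B>_def by auto
    have "U \<in> sets N" if U: "openin ?T U" for U
    proof -
      have "U = \<Union>{V\<in>\<B>. V \<subseteq> U}"
      proof
        show "U \<subseteq> \<Union>{V\<in>\<B>. V \<subseteq> U}"
        proof
          fix x assume "x \<in> U"
          from \<B>_base[OF U this] obtain V where "V \<in> \<B>" "x \<in> V" "V \<subseteq> U" by (elim bexE) simp
          then show "x \<in> \<Union>{V\<in>\<B>. V \<subseteq> U}" by (intro UnionI[of V]) simp_all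
        qed
      qed auto
      moreover have "\<Union>{V\<in>\<B>. V \<subseteq> U} \<in> sets N"
        by (rule sets.countable_Union)
          (use \<B>_count \<B>_sets in \<open>auto intro: countable_subset[OF _ \<B>_count]\<close>)
      ultimately show ?thesis by simp
    qed
    then show "sigma_sets (space N) {V. openin ?T V} \<subseteq> sets N"
      by (intro sets.sigma_sets_subset) auto
    have "sets N = sig N (\<lambda>f x. x f) I"
      by (rule sets_eq_sig) fact
    also have "\<dots> \<subseteq> sigma_sets (space N) {V. openin ?T V}"
      unfolding sig_def
    proof (rule sigma_sets_mono, safe)
      fix f i assume "f \<in> I"
      then have "evt N (\<lambda>f x. x f) f i \<in> \<B>"
        unfolding \<B>_def by (intro image_eqI[of _ _ "({f}, \<lambda>g\<in>{f}. i)"]) (auto simp: cyl_def evt_def)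
      then show "evt N (\<lambda>f x. x f) f i \<in> sigma_sets (space N) {V. openin ?T V}"
        using \<B>_open by auto
    qed
    finally show "sets N \<subseteq> sigma_sets (space N) {V. openin ?T V}" .
  qed
qed

context shift_cayley_tree begin

text \<open>Translation of the argument from the right makes \<open>t \<mapsto> act t\<close> a homomorphism, and the value of
  \<open>act t x\<close> at the identity is \<open>x t\<close>.\<close>

definition shift_process :: "('a \<Rightarrow> nat) measure \<Rightarrow> ('a, 'a \<Rightarrow> nat) process" where
  "shift_process N = \<lparr>msr = N, act = (\<lambda>t x. \<lambda>f\<in>carrier G. x (f \<otimes> t)), atom = (\<lambda>i. {x \<in> space N. x \<one> = i})\<rparr>"

lemma shift_process_simps [simp]:
  "msr (shift_process N) = N" "act (shift_process N) t = (\<lambda>x. \<lambda>f\<in>carrier G. x (f \<otimes> t))"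
  "atom (shift_process N) i = {x \<in> space N. x \<one> = i}"
  by (simp_all add: shift_process_def)

text \<open>The translated coordinates form a Markov chain with the same transition probabilities, and by
  stationarity with the same distribution at the root. Uniqueness of the law gives invariance.\<close>

lemma shift_process_markov:
  assumes N: "weight_law p P N" and cons: "consistent p P"
  shows "markov_process G S (shift_process N)" "generating G (shift_process N)"
    "\<And>s a b. s \<in> S \<Longrightarrow> measure N (atom (shift_process N) a \<inter> translate (shift_process N) s b) = p a * P s a b"
proof -
  let ?X = "shift_process N" and ?Z = "\<lambda>(f::'a) x. x f :: nat"
  have prob: "prob_space N" and sets: "sets N = sets (PiM (carrier G) (\<lambda>_. count_space (UNIV :: nat set)))"
    using N by (auto simp: weight_law_def)
  have sp: "space N = PiE (carrier G) (\<lambda>_. UNIV)" using sets_eq_imp_space_eq[OF sets] by (simp add: space_PiM)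
  interpret nat_process N ?Z "carrier G" by (rule nat_process_PiM) fact+
  note markov = weight_law_markov(1)[OF N cons] and marginal = weight_law_markov(2)[OF N cons]
  have meas: "act ?X t \<in> measurable N N" and inv: "distr N N (act ?X t) = N" if t: "t \<in> carrier G" for t
  proof -
    interpret T: nat_process N "\<lambda>f x. x (f \<otimes> t)" "carrier G"
      by unfold_locales (use Z_measurable t in auto)
    show "act ?X t \<in> measurable N N"
      using T.code_measurable by (simp add: measurable_cong_sets[OF refl sets])
    have "weight_law p P T.law"
    proof (rule tree_markov_law[OF T.nat_process_axioms tree_markov_shift[OF markov t]])
      show "measure N (evt N (\<lambda>f x. x (f \<otimes> t)) \<one> a) = p a" for a
        using marginal[OF t] t by (simp add: evt_def)
    qed
    then have "T.law = N" using weight_law_unique N by auto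
    then show "distr N N (act ?X t) = N"
      unfolding T.law_def using distr_cong[of N N N "PiM (carrier G) (\<lambda>_. count_space UNIV)"] sets by simp
  qed
  have ord: "ordered_process G ?X"
    unfolding ordered_process_def
  proof (intro conjI ballI allI)
    show "standard_prob_space (msr ?X)"
      using standard_prob_space_sequences[OF carrier_countable prob sets] by simp
    show "atom ?X i \<in> sets (msr ?X)" for i
      using evt_sets[OF one_closed, of i] by (simp add: evt_def)
    show "act ?X \<one> x = x" if "x \<in> space (msr ?X)" for x
      using that by (auto simp: sp fun_eq_iff PiE_iff extensional_def)
  qed (use meas inv in \<open>auto simp: disjoint_family_on_def m_assoc fun_eq_iff\<close>)
  interpret X: cayley_process G S len ?X
    by unfold_locales (rule ord)
  have coord: "coord ?X f x = x f" if "f \<in> carrier G" "x \<in> space N" for f x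
    unfolding coord_def using that X.act_space[of f x] by (subst X.label_iff) auto
  have evt: "evt N (coord ?X) f i = evt N ?Z f i" if "f \<in> carrier G" for f i
    unfolding evt_def using coord that by auto
  have sig: "sig N (coord ?X) Q = sig N ?Z Q" if "Q \<subseteq> carrier G" for Q
  proof -
    have "{evt N (coord ?X) f i |f i. f \<in> Q} = {evt N ?Z f i |f i. f \<in> Q}"
      using evt that by blast
    then show ?thesis unfolding sig_def by simp
  qed
  have joint: "X.joint s a b = p a * P s a b" if s: "s \<in> S" for s a b
  proof -
    have "measure N (space N \<inter> evt N ?Z \<one> a \<inter> evt N ?Z (s \<otimes> \<one>) b) = measure N (space N \<inter> evt N ?Z \<one> a) * P s a b"
      using markov s space_in_sig unfolding tree_markov_def by blast
    moreover have "space N \<inter> evt N ?Z \<one> a = evt N ?Z \<one> a" by (auto simp: evt_def)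
    ultimately have "measure N (evt N ?Z \<one> a \<inter> evt N ?Z s b) = p a * P s a b"
      using marginal s by simp
    then show ?thesis
      unfolding X.joint_def using X.translate_evt[of s b] evt[of s b] s by (simp add: evt_def)
  qed
  then show "\<And>s a b. s \<in> S \<Longrightarrow> measure N (atom ?X a \<inter> translate ?X s b) = p a * P s a b"
    unfolding X.joint_def by simp
  have "tree_markov N (coord ?X) P"
    unfolding tree_markov_def
  proof (intro ballI allI)
    fix s g A a b assume "s \<in> S" "g \<in> carrier G" "A \<in> sig N (coord ?X) (Past G S (s \<otimes> g) g)"
    then show "measure N (A \<inter> evt N (coord ?X) g a \<inter> evt N (coord ?X) (s \<otimes> g) b) =
        measure N (A \<inter> evt N (coord ?X) g a) * P s a b"
      using markov sig[OF Past_carrier] evt unfolding tree_markov_def by simp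
  qed
  moreover have "measure N (atom ?X a) = p a" for a
    using marginal[OF one_closed, of a] by (simp add: evt_def)
  ultimately show "markov_process G S ?X"
    using X.markov_iff_tree_markov[of P] joint cons by (auto simp: consistent_def)
  have "sets (join ?X (carrier G)) = sets N"
    using X.sets_join[OF order_refl] sig[OF order_refl] sets_eq_sig[OF sets] by simp
  then show "generating G ?X" unfolding generating_def by (auto intro!: bexI)
qed

end

section \<open>The Markov process of a given process\<close>

context cayley_process begin

definition marginal :: "nat \<Rightarrow> real" where
  "marginal a = measure M (atom X a)"

text \<open>On a null atom, or for a letter outside \<open>S\<close>, the distribution of the label is a default that
  keeps the kernel a probability measure.\<close>

definition kernel :: "'a \<Rightarrow> nat \<Rightarrow> nat measure" where
  "kernel s a = (if s \<in> S \<and> marginal a \<noteq> 0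
     then distr (uniform_measure M (atom X a)) (count_space UNIV) (coord X s)
     else distr M (count_space UNIV) (label X))"

definition transition :: "'a \<Rightarrow> nat \<Rightarrow> nat \<Rightarrow> real" where
  "transition s a b = measure (kernel s a) {b}"

lemma kernel_prob: "prob_space (kernel s a)" and kernel_sets: "sets (kernel s a) = UNIV"
proof -
  show "prob_space (kernel s a)"
  proof (cases "s \<in> S \<and> marginal a \<noteq> 0")
    case True
    then have "prob_space (uniform_measure M (atom X a))"
      by (intro prob_space_uniform_measure) (auto simp: marginal_def emeasure_eq_measure)
    moreover have "coord X s \<in> measurable (uniform_measure M (atom X a)) (count_space UNIV)"
      using Z_measurable True by simp
    ultimately show ?thesis using True unfolding kernel_def by (simp add: prob_space.prob_space_distr)
  next
    case False
    then show ?thesis unfolding kernel_def using prob_space_distr[OF label_measurable] by auto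
  qed
qed (simp add: kernel_def)

lemma joint_eq_transition: assumes "s \<in> S" shows "joint s a b = marginal a * transition s a b"
proof (cases "marginal a = 0")
  case True
  have "joint s a b \<le> marginal a" unfolding joint_def marginal_def
    by (rule finite_measure_mono) (use atom_sets in auto)
  then show ?thesis using True by (simp add: joint_def measure_le_0_iff)
next
  case False
  have c: "coord X s \<in> measurable (uniform_measure M (atom X a)) (count_space UNIV)"
    using Z_measurable assms by simp
  have "coord X s -` {b} \<inter> space M = translate X s b"
    using translate_evt[of s b] assms by (auto simp: evt_def)
  then have "transition s a b = measure (uniform_measure M (atom X a)) (translate X s b)"
    unfolding transition_def kernel_def using False assms measure_distr[OF c, of "{b}"] by simp
  also have "\<dots> = joint s a b / marginal a"
    unfolding joint_def marginal_def using False atom_sets[of a] translate_sets[of s b] assms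
    by (intro measure_uniform_measure) (auto simp: marginal_def emeasure_eq_measure)
  finally show ?thesis using False by simp
qed

lemma root_law: "measure (distr M (count_space UNIV) (label X)) {a} = marginal a"
proof -
  have "label X -` {a} \<inter> space M = atom X a"
    using label_iff sets.sets_into_space[OF atom_sets[of a]] by auto
  then show ?thesis using measure_distr[OF label_measurable, of "{a}"] by (simp add: marginal_def)
qed

text \<open>Both conditions hold because the action preserves the measure: stationarity for the translate
  by \<open>s\<close>, reversibility because \<open>act s'\<close> undoes \<open>act s\<close> if \<open>s' \<otimes> s = \<one>\<close>.\<close>

lemma consistent_transition: "consistent marginal transition"
  unfolding consistent_def
proof (intro conjI allI ballI impI)
  show "0 \<le> transition s a b" for s a b by (simp add: transition_def)
  show "transition s a b \<le> 1" for s a b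
    unfolding transition_def using kernel_prob by (rule prob_space.prob_le_1)
  show "(\<lambda>a. marginal a * transition s a b) sums marginal b" if "s \<in> S" for s b
  proof -
    have "(\<lambda>a. measure M (translate X s b \<inter> evt M (coord X) \<one> a)) sums measure M (translate X s b)"
      by (rule measure_evt_sums) (use translate_sets that in auto)
    moreover have "measure M (translate X s b \<inter> evt M (coord X) \<one> a) = marginal a * transition s a b" for a
      unfolding joint_eq_transition[OF that, symmetric] joint_def
      by (simp add: translate_one flip: translate_evt) (simp add: Int_commute)
    moreover have "measure M (translate X s b) = marginal b"
      using measure_evt[of s b] translate_evt[of s b] that by (simp add: marginal_def)
    ultimately show ?thesis by simp
  qed
  show "marginal b * transition s' b a = marginal a * transition s a b"
    if s: "s \<in> S" "s' \<in> S" "s' \<otimes> s = \<one>" for s s' a b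
  proof -
    have "act X s -` (atom X b \<inter> translate X s' a) \<inter> space M = atom X a \<inter> translate X s b"
    proof -
      have "act X s' (act X s x) = x" if "x \<in> space M" for x
        using act_mult[of s' s x] act_one[OF that] s that by simp
      then show ?thesis using act_space[of s] s sets.sets_into_space[OF atom_sets[of a]]
        by (auto simp: translate_def)
    qed
    then have "joint s' b a = joint s a b"
      using measure_act[of s "atom X b \<inter> translate X s' a"] s atom_sets translate_sets
      by (simp add: joint_def)
    then show ?thesis using joint_eq_transition s by simp
  qed
qed

end

lemma d1_eq_0_iff:
  assumes "finite S"
  shows "d1 S X Y = 0 \<longleftrightarrow> (\<forall>s\<in>S. \<forall>i j. measure (msr X) (atom X i \<inter> translate X s j) = measure (msr Y) (atom Y i \<inter> translate Y s j))"
  unfolding d1_def using assms by (simp add: sum_eq_0_iff suminf_eq_zero_iff ennreal_eq_0_iff)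

lemma (in cayley_process) marginal_sums: "s \<in> S \<Longrightarrow> (\<lambda>b. joint s a b) sums marginal a"
  using measure_evt_sums[OF atom_sets[of a], of s]
  by (simp add: joint_def marginal_def translate_evt)

text \<open>Both processes in the uniqueness statement have the joint distributions of \<open>Y\<close> along the
  generators, hence also its marginal, and are Markov with the transition probabilities of \<open>Y\<close>. The
  product formula then gives them the same law.\<close>

theorem (in shift_cayley_tree) markov_realisation:
  fixes Y :: "('a, 'y) process"
  assumes "ordered_process G Y"
  shows "(\<exists>X :: ('a, 'a \<Rightarrow> nat) process. markov_process G S X \<and> generating G X \<and> d1 S X Y = 0)
       \<and> (\<forall>(X1 :: ('a, 'x1) process) (X2 :: ('a, 'x2) process).
            markov_process G S X1 \<and> generating G X1 \<and> d1 S X1 Y = 0 \<and>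
            markov_process G S X2 \<and> generating G X2 \<and> d1 S X2 Y = 0
            \<longrightarrow> process_isomorphic G X1 X2)"
proof (intro conjI allI impI)
  interpret Y: cayley_process G S len Y by unfold_locales fact
  let ?p = Y.marginal and ?P = Y.transition
  obtain N where "weight_law (\<lambda>a. measure (distr (msr Y) (count_space UNIV) (label Y)) {a})
      (\<lambda>s a b. measure (Y.kernel s a) {b}) N"
    using weight_law_exists[of "distr (msr Y) (count_space UNIV) (label Y)" Y.kernel]
      Y.prob_space_distr[OF Y.label_measurable] Y.kernel_prob Y.kernel_sets by auto
  then have N: "weight_law ?p ?P N" unfolding Y.root_law Y.transition_def[abs_def] .
  note model = shift_process_markov[OF N Y.consistent_transition]
  have "d1 S (shift_process N) Y = 0"
    unfolding d1_eq_0_iff[OF S_finite] using model(3) Y.joint_eq_transition by (simp add: Y.joint_def)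
  then show "\<exists>X :: ('a, 'a \<Rightarrow> nat) process. markov_process G S X \<and> generating G X \<and> d1 S X Y = 0"
    using model by blast
  have law: "weight_law ?p ?P (nat_process.law (msr X) (coord X) (carrier G))"
    if X: "markov_process G S X" "d1 S X Y = 0" for X :: "('a, 'x) process"
  proof -
    interpret X: cayley_process G S len X
      by unfold_locales (use X in \<open>simp add: markov_process_def\<close>)
    have joint: "X.joint s a b = Y.joint s a b" if "s \<in> S" for s a b
      using X(2) that unfolding d1_eq_0_iff[OF S_finite] X.joint_def Y.joint_def by blast
    obtain s where s: "s \<in> S" using S_nonempty by auto
    have "X.marginal a = Y.marginal a" for a
      using X.marginal_sums[OF s, of a] Y.marginal_sums[OF s, of a] joint[OF s] sums_unique2 by simp
    then have marg: "measure (msr X) (atom X a) = ?p a" for a by (simp add: X.marginal_def)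
    have "tree_markov (msr X) (coord X) ?P"
      using X.markov_iff_tree_markov[of ?P] X(1) Y.consistent_transition
      by (auto simp: consistent_def joint marg Y.joint_eq_transition)
    then show ?thesis
      by (rule tree_markov_law[OF X.nat_process_axioms]) (simp add: X.measure_evt marg)
  qed
  fix X1 :: "('a, 'x1) process" and X2 :: "('a, 'x2) process"
  assume A: "markov_process G S X1 \<and> generating G X1 \<and> d1 S X1 Y = 0 \<and>
            markov_process G S X2 \<and> generating G X2 \<and> d1 S X2 Y = 0"
  show "process_isomorphic G X1 X2"
  proof (rule generating_same_law_isomorphic)
    show "cayley_process G S len X1" "cayley_process G S len X2"
      using A left_cayley_tree_axioms
      by (auto simp: markov_process_def cayley_process_def cayley_process_axioms_def)
    show "nat_process.law (msr X1) (coord X1) (carrier G) = nat_process.law (msr X2) (coord X2) (carrier G)"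
      using law[of X1] law[of X2] A weight_law_unique by blast
  qed (use A in auto)
qed

section \<open>Free groups and free semigroups\<close>

text \<open>Every edge of the free semigroup leads away from the identity, and the branch above \<open>k\<close>
  consists of the left multiples of \<open>k\<close>. Compatibility of pasts with right multiplication is right
  cancellation.\<close>

lemma free_semigroup_tree:
  fixes G (structure)
  assumes r: "r \<ge> 1" and free: "free_semigroup_on G s r" and S: "S = s ` {1..r}"
  shows "\<exists>len. shift_cayley_tree G S len"
proof -
  interpret monoid G using free unfolding free_semigroup_on_def by simp
  define ev where "ev = (\<lambda>w. foldr (\<lambda>i g. s i \<otimes> g) w \<one>)"
  have S_sub: "s ` {1..r} \<subseteq> carrier G" and bij: "bij_betw ev (lists {1..r}) (carrier G)"
    using free unfolding free_semigroup_on_def ev_def by auto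
  have s_closed: "s i \<in> carrier G" if "i \<in> {1..r}" for i using S_sub that by auto
  have ev_closed: "ev w \<in> carrier G" if "w \<in> lists {1..r}" for w
    using bij that by (auto simp: bij_betw_def)
  have ev_simps: "ev [] = \<one>" "ev (i # w) = s i \<otimes> ev w" for i w by (simp_all add: ev_def)
  have ev_append: "ev (u @ v) = ev u \<otimes> ev v" if "u \<in> lists {1..r}" "v \<in> lists {1..r}" for u v
    using that(1)
  proof (induction u)
    case (Cons i u)
    then show ?case using s_closed ev_closed that(2) by (simp add: ev_simps m_assoc)
  qed (use ev_closed[OF that(2)] in \<open>simp add: ev_simps\<close>)
  define wd where "wd = the_inv_into (lists {1..r}) ev"
  have wd_ev: "wd (ev w) = w" if "w \<in> lists {1..r}" for w
    unfolding wd_def using bij that by (intro the_inv_into_f_f) (auto simp: bij_betw_def)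
  have ev_wd: "ev (wd g) = g" and wd_lists: "wd g \<in> lists {1..r}" if "g \<in> carrier G" for g
  proof -
    obtain w where "w \<in> lists {1..r}" "g = ev w" using bij \<open>g \<in> carrier G\<close> by (auto simp: bij_betw_def)
    then show "ev (wd g) = g" "wd g \<in> lists {1..r}" using wd_ev by auto
  qed
  have wd_mult: "wd (g \<otimes> h) = wd g @ wd h" if "g \<in> carrier G" "h \<in> carrier G" for g h
    using wd_ev[of "wd g @ wd h"] ev_append[of "wd g" "wd h"] ev_wd wd_lists that by simp
  have wd_s: "wd (s i) = [i]" if "i \<in> {1..r}" for i
    using wd_ev[of "[i]"] that s_closed[OF that] by (simp add: ev_simps)
  have wd_inj: "g = h" if "wd g = wd h" "g \<in> carrier G" "h \<in> carrier G" for g h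
    using ev_wd that by metis
  have wd_one: "wd \<one> = []" using wd_ev[of "[]"] by (simp add: ev_simps)
  define len where "len = (\<lambda>g. length (wd g))"
  have len_s: "len (s i \<otimes> g) = Suc (len g)" if "i \<in> {1..r}" "g \<in> carrier G" for i g
    using that s_closed by (simp add: len_def wd_mult wd_s)
  interpret left_cayley_tree G S len
  proof
    show "countable (carrier G)"
      using bij countable_lists[of "{1..r}"] by (metis bij_betw_def countable_finite countable_image finite_atLeastAtMost)
    fix g assume g: "g \<in> carrier G"
    show "len g = 0 \<longleftrightarrow> g = \<one>" using wd_inj[of g \<one>] g wd_one by (auto simp: len_def)
    show "\<exists>s\<in>S. \<exists>h\<in>carrier G. g = s \<otimes> h \<and> len g = Suc (len h)" if ne: "g \<noteq> \<one>"
    proof -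
      obtain i w where w: "wd g = i # w" using ne wd_inj[of g \<one>] g wd_one by (cases "wd g") auto
      then have iw: "i \<in> {1..r}" "w \<in> lists {1..r}" using wd_lists[OF g] by auto
      have "g = s i \<otimes> ev w" using ev_wd[OF g] w by (simp add: ev_simps)
      then show ?thesis using iw len_s ev_closed S by blast
    qed
  next
    fix a b h h' assume a: "a \<in> S" "b \<in> S" and h: "h \<in> carrier G" "h' \<in> carrier G" and eq: "a \<otimes> h = b \<otimes> h'"
    obtain i j where ij: "a = s i" "b = s j" "i \<in> {1..r}" "j \<in> {1..r}" using a S by auto
    then have "i # wd h = j # wd h'" using wd_mult wd_s h s_closed arg_cong[OF eq, of wd] by simp
    then show "a = b \<and> h = h'" using ij wd_inj h by auto
  qed (use r S S_sub len_s in auto)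
  have desc: "f \<in> desc k \<longleftrightarrow> (\<exists>u\<in>carrier G. f = u \<otimes> k)" if k: "k \<in> carrier G" for f k
  proof
    assume "f \<in> desc k"
    then show "\<exists>u\<in>carrier G. f = u \<otimes> k"
    proof (induction rule: desc.induct)
      case desc_base
      then show ?case using k by (intro bexI[of _ \<one>]) auto
    next
      case (desc_step h t f)
      then obtain u where "u \<in> carrier G" "h = u \<otimes> k" by auto
      then show ?case using desc_step(2) k by (intro bexI[of _ "t \<otimes> u"]) (auto simp: child_def m_assoc)
    qed
  next
    have "ev w \<otimes> k \<in> desc k" if "w \<in> lists {1..r}" for w
      using that
    proof (induction w)
      case Nil
      then show ?case using k desc_base by (simp add: ev_simps)
    next
      case (Cons i w)
      then have "child (s i) (ev w \<otimes> k) (s i \<otimes> (ev w \<otimes> k))"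
        using k ev_closed len_s S unfolding child_def by auto
      then show ?case using Cons k s_closed ev_closed by (auto simp: ev_simps m_assoc intro: desc_step)
    qed
    then show "\<exists>u\<in>carrier G. f = u \<otimes> k \<Longrightarrow> f \<in> desc k" using ev_wd wd_lists by metis
  qed
  have "shift_cayley_tree G S len"
  proof
    fix a g t f assume a: "a \<in> S" and g: "g \<in> carrier G" and t: "t \<in> carrier G" and f: "f \<in> Past G S (a \<otimes> g) g"
    obtain i where i: "a = s i" "i \<in> {1..r}" using a S by auto
    have ch: "child a h (a \<otimes> h)" if "h \<in> carrier G" for h
      using that a i len_s unfolding child_def by auto
    have fc: "f \<in> carrier G" "f \<notin> desc (a \<otimes> g)" using f Past_child[OF ch[OF g]] by auto
    have "f \<otimes> t \<notin> desc (a \<otimes> g \<otimes> t)"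
    proof
      assume "f \<otimes> t \<in> desc (a \<otimes> g \<otimes> t)"
      then obtain u where u: "u \<in> carrier G" "f \<otimes> t = u \<otimes> (a \<otimes> g \<otimes> t)"
        using desc[of "a \<otimes> g \<otimes> t"] a g t by auto
      then have "wd f @ wd t = wd (u \<otimes> (a \<otimes> g)) @ wd t"
        using a g t fc by (simp add: m_assoc flip: wd_mult)
      then have "f = u \<otimes> (a \<otimes> g)" using wd_inj[of f "u \<otimes> (a \<otimes> g)"] u fc a g by simp
      then show False using fc desc[of "a \<otimes> g"] u a g by auto
    qed
    then show "f \<otimes> t \<in> Past G S (a \<otimes> g \<otimes> t) (g \<otimes> t)"
      using Past_child[OF ch[of "g \<otimes> t"]] a g t fc by (simp add: m_assoc)
  qed
  then show ?thesis by blast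
qed

text \<open>A generator or its inverse either prolongs the reduced word of \<open>g\<close> or cancels its first
  letter. Right multiplication by \<open>inv t\<close> maps paths to paths, hence right multiplication by \<open>t\<close>
  preserves pasts.\<close>

lemma free_group_tree:
  fixes G (structure)
  assumes r: "r \<ge> 1" and free: "free_group_on G s r" and S: "S = s ` {1..r} \<union> (\<lambda>i. inv (s i)) ` {1..r}"
  shows "\<exists>len. shift_cayley_tree G S len"
proof -
  interpret group G using free unfolding free_group_on_def by simp
  define L where "L = {1..r} \<times> (UNIV :: bool set)"
  define flip where "flip = (\<lambda>l :: nat \<times> bool. (fst l, \<not> snd l))"
  define ev where "ev = (\<lambda>w. foldr (\<lambda>l g. letter G s l \<otimes> g) w \<one>)"
  let ?R = "reduced_words r"
  have S_sub: "s ` {1..r} \<subseteq> carrier G" and bij: "bij_betw ev ?R (carrier G)"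
    using free unfolding free_group_on_def ev_def by auto
  have S_L: "S = letter G s ` L"
    unfolding S L_def letter_def by (force simp: image_iff)
  have letter_closed [simp]: "letter G s l \<in> carrier G" if "l \<in> L" for l
    using S_sub that unfolding letter_def L_def by auto
  have flip: "flip l \<in> L" "letter G s (flip l) \<otimes> letter G s l = \<one>" "flip (flip l) = l" if "l \<in> L" for l
    using S_sub that unfolding flip_def letter_def L_def by auto
  have reduced_Cons: "l # w \<in> ?R \<longleftrightarrow> l \<in> L \<and> w \<in> ?R \<and> (\<forall>w'. w \<noteq> flip l # w')" for l w
    unfolding reduced_words_def L_def flip_def
    by (cases w; cases l) (auto simp: prod_eq_iff)
  have ev_simps: "ev [] = \<one>" "ev (l # w) = letter G s l \<otimes> ev w" for l w by (simp_all add: ev_def)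
  have ev_closed: "ev w \<in> carrier G" if "w \<in> ?R" for w
    using bij that by (auto simp: bij_betw_def)
  define wd where "wd = the_inv_into ?R ev"
  have wd_ev: "wd (ev w) = w" if "w \<in> ?R" for w
    unfolding wd_def using bij that by (intro the_inv_into_f_f) (auto simp: bij_betw_def)
  have ev_wd: "ev (wd g) = g" and wd_R: "wd g \<in> ?R" if "g \<in> carrier G" for g
  proof -
    obtain w where "w \<in> ?R" "g = ev w" using bij \<open>g \<in> carrier G\<close> by (auto simp: bij_betw_def)
    then show "ev (wd g) = g" "wd g \<in> ?R" using wd_ev by auto
  qed
  have wd_inj: "g = h" if "wd g = wd h" "g \<in> carrier G" "h \<in> carrier G" for g h
    using ev_wd that by metis
  have nil: "[] \<in> ?R" by (simp add: reduced_words_def)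
  have wd_one: "wd \<one> = []" using wd_ev[OF nil] by (simp add: ev_simps)
  \<comment> \<open>Either the letter is prepended, or it cancels the first letter of the word.\<close>
  have wd_mult: "wd (letter G s l \<otimes> g) = l # wd g \<or> wd g = flip l # wd (letter G s l \<otimes> g)"
    if l: "l \<in> L" and g: "g \<in> carrier G" for l g
  proof (cases "l # wd g \<in> ?R")
    case True
    then show ?thesis using wd_ev[OF True] ev_wd[OF g] by (simp add: ev_simps)
  next
    case False
    then obtain w where w: "wd g = flip l # w" using reduced_Cons wd_R[OF g] l by blast
    then have wR: "w \<in> ?R" using wd_R[OF g] reduced_Cons by auto
    have "g = letter G s (flip l) \<otimes> ev w" using ev_wd[OF g] w by (simp add: ev_simps)
    then have "letter G s l \<otimes> g = (letter G s (flip (flip l)) \<otimes> letter G s (flip l)) \<otimes> ev w"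
      using flip(1,3)[OF l] l ev_closed[OF wR] by (simp add: m_assoc)
    then have "letter G s l \<otimes> g = ev w" using flip(2)[OF flip(1)[OF l]] ev_closed[OF wR] by simp
    then show ?thesis using w wd_ev[OF wR] by simp
  qed
  define len where "len = (\<lambda>g. length (wd g))"
  have wd_up: "wd (letter G s l \<otimes> g) = l # wd g"
    if "l \<in> L" "g \<in> carrier G" "len (letter G s l \<otimes> g) = Suc (len g)" for l g
    using wd_mult[OF that(1,2)] that(3) by (auto simp: len_def)
  have "shift_cayley_tree G S len"
  proof
    show "countable (carrier G)"
    proof -
      have "countable ?R" by (rule countable_subset[of _ "lists L"]) (auto simp: reduced_words_def L_def)
      then show ?thesis using bij by (metis bij_betw_def countable_image)
    qed
    show "S \<subseteq> carrier G" "finite S" "S \<noteq> {}" using S_L letter_closed r by (auto simp: L_def)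
    fix g assume g: "g \<in> carrier G"
    show "len g = 0 \<longleftrightarrow> g = \<one>" using wd_inj[of g \<one>] g wd_one by (auto simp: len_def)
    show "\<exists>s\<in>S. \<exists>h\<in>carrier G. g = s \<otimes> h \<and> len g = Suc (len h)" if ne: "g \<noteq> \<one>"
    proof -
      obtain l w where w: "wd g = l # w" using ne wd_inj[of g \<one>] g wd_one by (cases "wd g") auto
      then have lw: "l \<in> L" "w \<in> ?R" using wd_R[OF g] reduced_Cons by auto
      have "g = letter G s l \<otimes> ev w" using ev_wd[OF g] w by (simp add: ev_simps)
      moreover have "len g = Suc (len (ev w))" using w wd_ev[OF lw(2)] by (simp add: len_def)
      ultimately show ?thesis using lw ev_closed S_L by blast
    qed
  next
    fix a b h h' assume a: "a \<in> S" "b \<in> S" and h: "h \<in> carrier G" "h' \<in> carrier G" and eq: "a \<otimes> h = b \<otimes> h'"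
      and up: "len (a \<otimes> h) = Suc (len h)" "len (a \<otimes> h) = Suc (len h')"
    obtain k l where kl: "a = letter G s k" "b = letter G s l" "k \<in> L" "l \<in> L" using a S_L by auto
    then have "k # wd h = l # wd h'" using wd_up[of k h] wd_up[of l h'] h up eq by simp
    then show "a = b \<and> h = h'" using kl wd_inj h by auto
  next
    fix a g assume a: "a \<in> S" and g: "g \<in> carrier G"
    obtain l where l: "a = letter G s l" "l \<in> L" using a S_L by auto
    then show "len (a \<otimes> g) = Suc (len g) \<or> len g = Suc (len (a \<otimes> g)) \<and> (\<exists>s'\<in>S. s' \<otimes> a = \<one>)"
      using wd_mult[OF l(2) g] flip[OF l(2)] S_L unfolding len_def by auto
  next
    fix a g t f assume a: "a \<in> S" and g: "g \<in> carrier G" and t: "t \<in> carrier G" and f: "f \<in> Past G S (a \<otimes> g) g"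
    have S_closed: "x \<in> carrier G" if "x \<in> S" for x using that S_L by auto
    have fc: "f \<in> carrier G" using f unfolding Past_def by auto
    have "g \<otimes> t \<in> set p" if p: "cayley_path G S (f \<otimes> t) (a \<otimes> g \<otimes> t) p" for p
    proof -
      let ?p = "map (\<lambda>x. x \<otimes> inv t) p"
      have pc: "set p \<subseteq> carrier G" "p \<noteq> []" using p by (auto simp: cayley_path_def)
      have cancel: "x \<otimes> t \<otimes> inv t = x" if "x \<in> carrier G" for x using that t by (simp add: m_assoc)
      have "successively (\<lambda>x y. \<exists>s\<in>S. y = s \<otimes> x \<or> x = s \<otimes> y) ?p"
        unfolding successively_map
        by (rule successively_mono[of "\<lambda>x y. \<exists>s\<in>S. y = s \<otimes> x \<or> x = s \<otimes> y"])
          (use p pc S_closed t in \<open>auto simp: cayley_path_def m_assoc subset_iff\<close>)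
      then have "cayley_path G S f (a \<otimes> g) ?p"
        using p pc t fc a g S_closed cancel by (auto simp: cayley_path_def hd_map last_map)
      then have "g \<in> set ?p" using f unfolding Past_def by auto
      then obtain x where "x \<in> set p" "g = x \<otimes> inv t" by auto
      then show ?thesis using pc t by (auto simp: m_assoc subset_iff)
    qed
    then show "f \<otimes> t \<in> Past G S (a \<otimes> g \<otimes> t) (g \<otimes> t)" using fc t unfolding Past_def by auto
  qed
  then show ?thesis by blast
qed

theorem theorem7p1:
  fixes G :: "('g, 'm) monoid_scheme"
    and s :: "nat \<Rightarrow> 'g"
    and r :: nat
    and S :: "'g set"
    and Y :: "('g, 'y) process"
  assumes "r \<ge> 1"
    and "free_group_on G s r \<and> S = s ` {1..r} \<union> (\<lambda>i. inv\<^bsub>G\<^esub> (s i)) ` {1..r}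
       \<or> free_semigroup_on G s r \<and> S = s ` {1..r}"
    and "ordered_process G Y"
  shows "(\<exists>X :: ('g, 'g \<Rightarrow> nat) process.
            markov_process G S X \<and> generating G X \<and> d1 S X Y = 0)
       \<and> (\<forall>(X1 :: ('g, 'a) process) (X2 :: ('g, 'b) process).
            markov_process G S X1 \<and> generating G X1 \<and> d1 S X1 Y = 0 \<and>
            markov_process G S X2 \<and> generating G X2 \<and> d1 S X2 Y = 0
            \<longrightarrow> process_isomorphic G X1 X2)"
proof -
  obtain len where "shift_cayley_tree G S len"
    using assms(2) free_group_tree[OF assms(1)] free_semigroup_tree[OF assms(1)] by blast
  then show ?thesis using assms(3) by (rule shift_cayley_tree.markov_realisation)
qed

end
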